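(* For $i=0,1$ let $L_i$ be a multiset of integers congruent to $i\pmod 2$ and greater than $2$, and let $a\in\{0,1\}$. Set \[\epsilon_0=\max\Big(1,\ 2|L_0|\big(\max(L_0)+3\big)-1\Big),\qquad \epsilon_1=\max\Big(3,\ 7^{|L_1|+a-1}\big(2\max(L_1)+1\big)\Big).\] Then for every $\epsilon\ge 6\epsilon_0+7\epsilon_1+9$ there exists a graceful labeling $\Gamma$ of $\left[L_0,L_1,{}^a2\ \middle|\ \epsilon-\sum_{\ell\in L_0\cup L_1}\ell-2a\right]$ such that $\Delta_p\Gamma\supseteq\mathcal{I}(4\epsilon_0+5\epsilon_1+7,\ \epsilon)$.
   Context: $\mathcal{I}(a,b)=\{x\in\mathbb{Z}\mid a\le x\le b\}$; $|L|$ counts multiplicity; the maximum of an empty multiset is $0$; $L_0\cup L_1$ is the multiset union. $[L_0,L_1,{}^a2\mid m]$ is the vertex-disjoint union of one $\ell$-cycle for each $\ell\in L_0\cup L_1$, $a$ cycles of length $2$ (two vertices joined by two parallel edges), and a path with $m$ edges; its number of edges is $\epsilon=\sum\ell+2a+m$. A labeling is an isomorphic copy with distinct integer vertices; $\Delta\Gamma$ is the multiset of differences $u-w$ over ordered pairs of adjacent vertices (parallel edges counted separately), and $\Delta_p\Gamma$ is the same restricted to edges of the path. A graceful labeling of such a graph with $\epsilon$ edges is a labeling $\Gamma$ with vertex set $\mathcal{I}(0,\epsilon)$ such that $\Delta\Gamma=\pm\mathcal{I}(1,\epsilon)$ if there is no $2$-cycle, and $\Delta\Gamma=\pm\{1,3,3\}\cup\pm\mathcal{I}(4,\epsilon)$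 (as multisets) if there is exactly one $2$-cycle. *)

theory Defs
  imports Complex_Main "HOL-Library.Multiset"
begin

text \<open>Loopless multigraphs: \<open>edges\<close> is a multiset of two-element vertex sets, so that
  parallel edges are repeated elements.\<close>

record 'v mgraph =
  verts :: "'v set"
  edges :: "'v set multiset"

text \<open>For \<open>n = 2\<close> the edge \<open>{0, 1}\<close> occurs twice, so \<open>cycle_graph 2\<close> is the cycle of length 2
  formed by two parallel edges.\<close>

definition cycle_graph :: "nat \<Rightarrow> nat mgraph" where
  "cycle_graph n = \<lparr>verts = {..<n}, edges = {#{i, Suc i mod n}. i \<in># mset_set {..<n}#}\<rparr>"

definition path_graph :: "nat \<Rightarrow> nat mgraph" where
  "path_graph m = \<lparr>verts = {..m}, edges = {#{i, Suc i}. i \<in># mset_set {..<m}#}\<rparr>"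

definition map_mgraph :: "('v \<Rightarrow> 'w) \<Rightarrow> 'v mgraph \<Rightarrow> 'w mgraph" where
  "map_mgraph f G = \<lparr>verts = f ` verts G, edges = image_mset (image f) (edges G)\<rparr>"

text \<open>Vertex-disjoint union of a family of graphs indexed by a finite set.\<close>

definition disjoint_union :: "'i set \<Rightarrow> ('i \<Rightarrow> 'v mgraph) \<Rightarrow> ('i \<times> 'v) mgraph" where
  "disjoint_union I G =
     \<lparr>verts = (\<Union>i\<in>I. verts (map_mgraph (Pair i) (G i))),
      edges = (\<Sum>i\<in>I. edges (map_mgraph (Pair i) (G i)))\<rparr>"

text \<open>\<open>Cycle l j\<close> is the index of the \<open>j\<close>-th cycle of length \<open>l\<close>; the multiset of cycle lengths
  contains \<open>l\<close> as often as there are such cycles.\<close>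

datatype component = Path | Cycle nat nat

fun component_graph :: "nat \<Rightarrow> component \<Rightarrow> nat mgraph" where
  "component_graph m Path = path_graph m"
| "component_graph m (Cycle l j) = cycle_graph l"

definition components :: "nat multiset \<Rightarrow> component set" where
  "components L = insert Path {Cycle l j |l j. j < count L l}"

text \<open>The graph \<open>[L\<^sub>0, L\<^sub>1, \<^sup>a2 | m]\<close>.\<close>

definition cycles_path_graph ::
  "nat multiset \<Rightarrow> nat multiset \<Rightarrow> nat \<Rightarrow> nat \<Rightarrow> (component \<times> nat) mgraph" where
  "cycles_path_graph L0 L1 a m =
     disjoint_union (components (L0 + L1 + replicate_mset a 2)) (component_graph m)"

text \<open>The path, as a subgraph of \<open>[L\<^sub>0, L\<^sub>1, \<^sup>a2 | m]\<close>.\<close>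

definition path_part :: "nat \<Rightarrow> (component \<times> nat) mgraph" where
  "path_part m = map_mgraph (Pair Path) (path_graph m)"

text \<open>The multiset \<open>\<Delta>\<Gamma>\<close>: each edge \<open>{u, w}\<close> contributes both \<open>u - w\<close> and \<open>w - u\<close>.\<close>

definition differences :: "int mgraph \<Rightarrow> int multiset" where
  "differences \<Gamma> =
     (\<Sum>e\<in>#edges \<Gamma>. {#u - w. (u, w) \<in># mset_set {(u, w). u \<in> e \<and> w \<in> e \<and> u \<noteq> w}#})"

definition plus_minus :: "int multiset \<Rightarrow> int multiset" where
  "plus_minus M = M + image_mset uminus M"

text \<open>A labeling of \<open>G\<close> is given by an injective map \<open>f\<close> from its vertices to the integers; the
  isomorphic copy is \<open>\<Gamma> = map_mgraph f G\<close>. Keeping \<open>f\<close> rather than just \<open>\<Gamma>\<close> allows one to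
  refer to the copy of the path in \<open>\<Gamma>\<close>, which is \<open>map_mgraph f (path_part m)\<close>.
  Gracefulness is only defined for \<open>a \<le> 1\<close>.\<close>

definition labeling :: "('v \<Rightarrow> int) \<Rightarrow> 'v mgraph \<Rightarrow> bool" where
  "labeling f G \<longleftrightarrow> inj_on f (verts G)"

definition graceful_labeling ::
  "nat multiset \<Rightarrow> nat multiset \<Rightarrow> nat \<Rightarrow> nat \<Rightarrow> (component \<times> nat \<Rightarrow> int) \<Rightarrow> bool" where
  "graceful_labeling L0 L1 a m f \<longleftrightarrow>
     (let G = cycles_path_graph L0 L1 a m;
          \<Gamma> = map_mgraph f G;
          \<epsilon> = int (size (edges G))
      in labeling f G \<and> verts \<Gamma> = {0..\<epsilon>} \<and>
         (a = 0 \<and> differences \<Gamma> = plus_minus (mset_set {1..\<epsilon>}) \<or>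
          a = 1 \<and> differences \<Gamma> = plus_minus {#1, 3, 3#} + plus_minus (mset_set {4..\<epsilon>})))"

text \<open>The multiset \<open>\<Delta>\<^sub>p\<Gamma>\<close>.\<close>

definition path_differences :: "nat \<Rightarrow> (component \<times> nat \<Rightarrow> int) \<Rightarrow> int multiset" where
  "path_differences m f = differences (map_mgraph f (path_part m))"

definition max_mset :: "nat multiset \<Rightarrow> nat" where
  "max_mset L = (if L = {#} then 0 else Max (set_mset L))"

text \<open>The truncated subtractions below are harmless because of the outer maximum, as
  \<open>of_nat_eps0\<close> and \<open>of_nat_eps1\<close> show: the values \<open>-1\<close> for \<open>L\<^sub>0 = {#}\<close> and \<open>1/7\<close> for
  \<open>L\<^sub>1 = {#}\<close>, \<open>a = 0\<close> are replaced by \<open>0\<close> and \<open>1\<close>.\<close>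

definition eps0 :: "nat multiset \<Rightarrow> nat" where
  "eps0 L0 = max 1 (2 * size L0 * (max_mset L0 + 3) - 1)"

definition eps1 :: "nat multiset \<Rightarrow> nat \<Rightarrow> nat" where
  "eps1 L1 a = max 3 (7 ^ (size L1 + a - 1) * (2 * max_mset L1 + 1))"

lemma of_nat_eps0:
  "int (eps0 L0) = max 1 (2 * int (size L0) * (int (max_mset L0) + 3) - 1)"
proof (cases "L0 = {#}")
  case False
  then have "2 * size L0 * (max_mset L0 + 3) \<ge> 1"
    by (cases "size L0") auto
  then have "int (2 * size L0 * (max_mset L0 + 3) - 1)
      = 2 * int (size L0) * (int (max_mset L0) + 3) - 1"
    by (subst of_nat_diff) auto
  then show ?thesis
    by (simp add: eps0_def of_nat_max)
qed (simp add: eps0_def)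

lemma of_nat_eps1:
  "real (eps1 L1 a) =
     max 3 (7 powi (int (size L1) + int a - 1) * (2 * real (max_mset L1) + 1))"
proof (cases "size L1 + a")
  case 0
  then show ?thesis by (simp add: eps1_def max_mset_def power_int_def)
next
  case (Suc k)
  then have "int (size L1) + int a - 1 = int k" by linarith
  moreover have "real (eps1 L1 a) = max 3 (7 ^ k * (2 * real (max_mset L1) + 1))"
    using Suc by (simp add: eps1_def of_nat_max algebra_simps)
  ultimately show ?thesis by (simp only: power_int_of_nat)
qed

lemma finite_components: "finite (components L)"
proof -
  have "{Cycle l j |l j. j < count L l} = (\<Union>l\<in>set_mset L. Cycle l ` {..<count L l})"
    by (auto simp: image_iff) (metis gr_zeroI not_in_iff not_less_zero)
  then show ?thesis by (simp add: components_def)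
qed

lemma weighted_count_sum: "sum_mset (L :: nat multiset) = (\<Sum>l\<in>set_mset L. count L l * l)"
proof (induction L)
  case (add x L)
  have "(\<Sum>l\<in>set_mset (add_mset x L). count (add_mset x L) l * l) =
      (\<Sum>l\<in>insert x (set_mset L). count L l * l + (if l = x then l else 0))"
    by (intro sum.cong) auto
  also have "\<dots> = (\<Sum>l\<in>insert x (set_mset L). count L l * l) + x"
    by (simp add: sum.distrib)
  also have "(\<Sum>l\<in>insert x (set_mset L). count L l * l) = (\<Sum>l\<in>set_mset L. count L l * l)"
    by (rule sum.mono_neutral_right) (auto simp: not_in_iff)
  finally show ?case using add.IH by simp
qed simp

lemma size_edges_cycles_path_graph:
  "size (edges (cycles_path_graph L0 L1 a m)) = sum_mset (L0 + L1) + 2 * a + m"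
proof -
  define L where "L = L0 + L1 + replicate_mset a 2"
  define C where "C = {Cycle l j |l j. j < count L l}"
  have C: "C = (\<lambda>(l, j). Cycle l j) ` (SIGMA l:set_mset L. {..<count L l})"
    unfolding C_def by (auto simp: image_iff) (metis gr_zeroI not_in_iff not_less_zero)
  have fin: "finite C" unfolding C by auto
  have "Path \<notin> C" by (auto simp: C_def)
  then have "size (edges (cycles_path_graph L0 L1 a m)) =
      m + (\<Sum>c\<in>C. size (edges (component_graph m c)))"
    using fin by (simp add: cycles_path_graph_def components_def disjoint_union_def map_mgraph_def
      L_def[symmetric] C_def[symmetric] path_graph_def)
  also have "(\<Sum>c\<in>C. size (edges (component_graph m c))) =
      (\<Sum>(l, j)\<in>(SIGMA l:set_mset L. {..<count L l}). l)"
    unfolding C by (subst sum.reindex) (auto simp: inj_on_def cycle_graph_def intro!: sum.cong)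
  also have "\<dots> = (\<Sum>l\<in>set_mset L. count L l * l)"
    by (subst sum.Sigma[symmetric]) auto
  also have "\<dots> = sum_mset L"
    by (rule weighted_count_sum[symmetric])
  finally show ?thesis by (simp add: L_def)
qed

text \<open>The path length \<open>\<epsilon> - \<Sum>\<ell> - 2a\<close> is not a truncated difference once \<open>\<epsilon>\<close> is at least
  \<open>eps0 L0 + eps1 L1 a\<close>.\<close>

lemma sum_mset_le_max_mset: "sum_mset L \<le> size L * max_mset L"
proof -
  have "(\<Sum>l\<in>#L. l) \<le> (\<Sum>l\<in>#L. max_mset L)"
    by (intro sum_mset_mono) (auto simp: max_mset_def)
  then show ?thesis by simp
qed

lemma sum_mset_le_eps:
  assumes "\<And>l. l \<in># L1 \<Longrightarrow> l > 2" and "a \<in> {0, 1}"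
  shows "sum_mset (L0 + L1) + 2 * a \<le> eps0 L0 + eps1 L1 a"
proof -
  have 0: "sum_mset L0 \<le> eps0 L0"
  proof (cases "L0 = {#}")
    case False
    then have "size L0 \<ge> 1" by (cases "size L0") auto
    moreover have "2 * size L0 * (max_mset L0 + 3) = 2 * (size L0 * max_mset L0) + 6 * size L0"
      by (simp add: algebra_simps)
    ultimately show ?thesis
      using sum_mset_le_max_mset[of L0] unfolding eps0_def by linarith
  qed simp
  have 1: "sum_mset L1 + 2 * a \<le> eps1 L1 a"
  proof (cases "L1 = {#}")
    case True
    then show ?thesis using assms(2) by (auto simp: eps1_def)
  next
    case False
    then have "max_mset L1 \<in># L1" by (simp add: max_mset_def)
    then have M: "max_mset L1 > 2" by (rule assms(1))
    define k where "k = size L1 + a - 1"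
    have size: "size L1 \<le> Suc k" "a \<le> 1" using assms(2) by (auto simp: k_def)
    have "Suc k \<le> 7 ^ k" by (induction k) auto
    then have "Suc k * (2 * max_mset L1 + 1) \<le> 7 ^ k * (2 * max_mset L1 + 1)"
      by (rule mult_le_mono1)
    moreover have "Suc k * max_mset L1 \<ge> size L1 * max_mset L1"
      using size(1) by (rule mult_le_mono1)
    moreover have "Suc k * max_mset L1 \<ge> max_mset L1" by simp
    moreover have "Suc k * (2 * max_mset L1 + 1) = 2 * (Suc k * max_mset L1) + Suc k"
      by (simp add: algebra_simps)
    ultimately show ?thesis
      using sum_mset_le_max_mset[of L1] M size(2) unfolding eps1_def k_def[symmetric] by linarith
  qed
  from 0 1 show ?thesis by simp
qed

end

theory Submission
  imports Defs
begin

text \<open>Labelings are built from the inside outwards. Suppose that some cycles and a path are labeled by an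
  interval of length \<open>N\<close> with the differences \<open>1..N\<close>, and that the path ends next to an end point
  of the interval. Then the path can be continued by vertices on both sides of the interval; joining
  vertices of different sides only yields differences above \<open>N\<close>. Letting three strands grow
  outwards in parallel, namely the path and the two ends of a still open cycle, produces a cycle of any
  even length \<open>l\<close> out of \<open>3l/2 - 1\<close> vertices and leaves the path next to an end point again.

  This is bipartite, so odd cycles need a different idea. The first odd cycle (or the 2-cycle) sits in
  the centre of the labeling. For each further one, of length \<open>l\<close>, one sets aside a vertex \<open>z\<close>
  next to the interval together with the difference \<open>N + 1\<close>, extends the path to an interval of length
  \<open>2N + 1\<close>, and then starts a second path, which leaves out the difference \<open>2N + 2\<close>. Along with
  it one grows an even cycle of length \<open>l - 1\<close>, but replaces one of its edges \<open>xy\<close> by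
  \<open>x z y\<close>. If this happens when the interval has length \<open>3N + 1\<close>, then \<open>zx\<close> and \<open>zy\<close>
  have precisely the differences \<open>N + 1\<close> and \<open>2N + 2\<close>, and the second path can be stopped where
  the free difference of \<open>xy\<close> joins it to the first one. Each such step multiplies \<open>N\<close> by less than 7.
  At the end, the path alone is extended as far as desired.\<close>

section \<open>Differences and intervals\<close>

text \<open>Each edge is counted once, by its absolute difference; the signed multisets are
  recovered with \<open>plus_minus\<close> when the lists are turned into graphs.\<close>

fun path_diffs :: "int list \<Rightarrow> int multiset" where
  "path_diffs [] = {#}"
| "path_diffs [x] = {#}"
| "path_diffs (x # y # zs) = add_mset \<bar>x - y\<bar> (path_diffs (y # zs))"

text \<open>For a list of two vertices the difference is counted twice, as the two parallel edges of
  a 2-cycle require.\<close>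

definition cycle_diffs :: "int list \<Rightarrow> int multiset" where
  "cycle_diffs xs = add_mset \<bar>last xs - hd xs\<bar> (path_diffs xs)"

definition cycles_diffs :: "int list list \<Rightarrow> int multiset" where
  "cycles_diffs cs = (\<Sum>c\<leftarrow>cs. cycle_diffs c)"

lemma cycles_diffs_simps [simp]:
  "cycles_diffs [] = {#}"
  "cycles_diffs (c # cs) = cycle_diffs c + cycles_diffs cs"
  "cycles_diffs (cs @ cs') = cycles_diffs cs + cycles_diffs cs'"
  by (simp_all add: cycles_diffs_def)

lemma path_diffs_Cons: "xs \<noteq> [] \<Longrightarrow> path_diffs (x # xs) = add_mset \<bar>x - hd xs\<bar> (path_diffs xs)"
  by (cases xs) auto

lemma path_diffs_append:
  "xs \<noteq> [] \<Longrightarrow> ys \<noteq> [] \<Longrightarrow> path_diffs (xs @ ys) = path_diffs xs + add_mset \<bar>last xs - hd ys\<bar> (path_diffs ys)"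
  by (induction xs rule: path_diffs.induct) (auto simp: path_diffs_Cons)

lemma path_diffs_append_Cons: "path_diffs (xs @ ys) = path_diffs xs + path_diffs (last xs # ys)" if "xs \<noteq> []"
  using that path_diffs_append[of xs ys] by (cases ys) auto

lemma path_diffs_rev: "path_diffs (rev xs) = path_diffs xs"
proof (induction xs)
  case (Cons x xs)
  then show ?case
    by (cases "xs = []") (simp_all add: path_diffs_append path_diffs_Cons last_rev abs_minus_commute)
qed simp

lemma path_diffs_map:
  assumes "\<And>x y. \<bar>f x - f y\<bar> = \<bar>x - y\<bar>"
  shows "path_diffs (map f xs) = path_diffs xs"
  using assms by (induction xs rule: path_diffs.induct) auto

text \<open>The interval between \<open>a\<close> and \<open>a + s * N\<close>, where \<open>s = 1\<close> or \<open>s = -1\<close>. The sign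
  \<open>s\<close> lets every construction be treated together with its mirror image.\<close>

definition interval :: "int \<Rightarrow> int \<Rightarrow> int \<Rightarrow> int multiset" where
  "interval a s N = mset_set {min a (a + s * N)..max a (a + s * N)}"

lemma interval_near:
  assumes "\<bar>s\<bar> = 1" "N \<ge> 0"
  shows "interval (a - s) s (N + 1) = add_mset (a - s) (interval a s N)"
proof -
  from assms(1) consider "s = 1" | "s = -1" by linarith
  then show ?thesis
  proof cases
    case 1
    have "{a - 1..a + N} = insert (a - 1) {a..a + N}" using assms by auto
    then show ?thesis using 1 assms by (simp add: interval_def min_def max_def)
  next
    case 2
    have "{a - N..a + 1} = insert (a + 1) {a - N..a}" using assms by auto
    then show ?thesis using 2 assms by (simp add: interval_def min_def max_def)
  qed
qed

lemma interval_flip: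
  assumes "\<bar>s\<bar> = 1" "b = a + s * N"
  shows "interval b (- s) N = interval a s N"
  using assms by (simp add: interval_def min.commute max.commute)

lemma interval_far:
  assumes "\<bar>s\<bar> = 1" "N \<ge> 0" "b = a + s * (N + 1)"
  shows "interval a s (N + 1) = add_mset b (interval a s N)"
proof -
  have "interval a s (N + 1) = interval (a + s * N - (- s)) (- s) (N + 1)"
    using assms(1) by (subst interval_flip[of s, symmetric]) (auto simp: algebra_simps)
  also have "\<dots> = add_mset (a + s * N + s) (interval (a + s * N) (- s) N)"
    using assms by (subst interval_near) auto
  also have "interval (a + s * N) (- s) N = interval a s N"
    using assms by (intro interval_flip) auto
  finally show ?thesis using assms by (simp add: algebra_simps)
qed

lemma interval_grow:
  assumes "\<bar>s\<bar> = 1" "N \<ge> 0"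
  shows "interval (a - s * int i) s (N + int i + int j) =
    interval a s N + mset (map (\<lambda>k. a - s * int k) [1..<Suc i]) +
    mset (map (\<lambda>k. a + s * (N + int k)) [1..<Suc j])"
proof (induction j)
  case 0
  show ?case
  proof (induction i)
    case (Suc i)
    have "interval (a - s * int (Suc i)) s (N + int (Suc i) + int 0) =
        interval (a - s * int i - s) s (N + int i + 1)"
      by (simp add: algebra_simps)
    also have "\<dots> = add_mset (a - s * int i - s) (interval (a - s * int i) s (N + int i))"
      using assms by (intro interval_near) auto
    finally show ?case using Suc by (simp add: algebra_simps)
  qed simp
next
  case (Suc j)
  have "interval (a - s * int i) s (N + int i + int (Suc j)) =
      interval (a - s * int i) s (N + int i + int j + 1)"
    by (simp add: algebra_simps)
  also have "\<dots> = add_mset (a + s * (N + int (Suc j))) (interval (a - s * int i) s (N + int i + int j))"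
    using assms by (intro interval_far) (auto simp: algebra_simps)
  finally show ?case using Suc by (simp add: algebra_simps)
qed

section \<open>Growing a path together with cycles\<close>

text \<open>A growth step from \<open>interval a s N\<close> by \<open>T\<close> vertices adds \<open>T div 2\<close> of them beyond
  \<open>a\<close> and the others beyond \<open>a + s * N\<close>. The path then ends near the new end point beyond \<open>a\<close>
  if \<open>T\<close> is even, and near the opposite one if \<open>T\<close> is odd. This end point is \<open>front_base\<close>, and
  \<open>front_dir\<close> is the direction from it into the interval.\<close>

definition front_base :: "int \<Rightarrow> int \<Rightarrow> int \<Rightarrow> int \<Rightarrow> int" where
  "front_base a s N T = (if even T then a - s * (T div 2) else a + s * N + s * ((T + 1) div 2))"

definition front_dir :: "int \<Rightarrow> int \<Rightarrow> int" where
  "front_dir s T = (if even T then s else - s)"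

lemma abs_front_dir [simp]: "\<bar>front_dir s T\<bar> = \<bar>s\<bar>"
  by (simp add: front_dir_def)

lemma front_dir_trans: "front_dir (front_dir s T) T' = front_dir s (T + T')"
  by (auto simp: front_dir_def)

text \<open>The number of vertices is rounded down on the side of the current front, and an odd step
  moves the front to the other side. Hence the extra vertex of a second odd step goes to the side
  that received fewer before, and both sides end up with \<open>(T + T') div 2\<close>
  vertices.\<close>

lemma front_base_trans: "front_base (front_base a s N T) (front_dir s T) (N + T) T' = front_base a s N (T + T')"
proof -
  consider (ee) k l where "T = 2 * k" "T' = 2 * l" | (eo) k l where "T = 2 * k" "T' = 2 * l + 1"
    | (oe) k l where "T = 2 * k + 1" "T' = 2 * l" | (oo) k l where "T = 2 * k + 1" "T' = 2 * l + 1"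
    by (metis evenE oddE)
  then show ?thesis
  proof cases
    case oo
    then have "T + T' = 2 * (k + l + 1)" "T + 1 = 2 * (k + 1)" "T' + 1 = 2 * (l + 1)" by auto
    then show ?thesis using oo
      by (simp only: front_base_def front_dir_def) (simp add: algebra_simps)
  next
    case eo
    then have "T + T' + 1 = 2 * (k + l + 1)" "T' + 1 = 2 * (l + 1)" by auto
    then show ?thesis using eo
      by (simp only: front_base_def front_dir_def) (simp add: algebra_simps)
  next
    case oe
    then have "T + T' + 1 = 2 * (k + l + 1)" "T + 1 = 2 * (k + 1)" by auto
    then show ?thesis using oe
      by (simp only: front_base_def front_dir_def) (simp add: algebra_simps)
  next
    case ee
    then have "T + T' = 2 * (k + l)" by auto
    then show ?thesis using ee
      by (simp only: front_base_def front_dir_def) (simp add: algebra_simps)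
  qed
qed

lemma mset_interval_join:
  "k \<le> m \<Longrightarrow> m \<le> n \<Longrightarrow> mset_set {k + 1..m} + mset_set {m + 1..n::int} = mset_set {k + 1..n}"
  by (subst mset_set_Union[symmetric]) (auto intro!: arg_cong[of _ _ mset_set])

lemma mset_interval_Suc: "k \<le> n \<Longrightarrow> mset_set {k..n + 1::int} = add_mset (n + 1) (mset_set {k..n})"
proof -
  assume "k \<le> n"
  then have "{k..n + 1} = insert (n + 1) {k..n}" by auto
  then show ?thesis by simp
qed

text \<open>The list \<open>ys\<close> continues a path that ends at \<open>a + s\<close>; the \<open>cs\<close> are new cycles; the continued
  path ends at distance \<open>e\<close> from the front. The multiset \<open>X\<close> consists of vertices of the old
  interval that were set aside and are used now, \<open>E\<close> of such differences, and \<open>H\<close> of the new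
  differences that remain unused. The first new vertex is prescribed so that a path may also be started
  afresh with \<open>ys\<close>, which leaves out exactly the difference \<open>N + 1\<close>.\<close>

definition growth where
  "growth X H E e a s N T ys cs \<longleftrightarrow>
     mset ys + mset (concat cs) + interval a s N = interval (front_base a s N T) (front_dir s T) (N + T) + X \<and>
     path_diffs ((a + s) # ys) + cycles_diffs cs + H = mset_set {N + 1..N + T} + E \<and>
     last ((a + s) # ys) = front_base a s N T + e * front_dir s T \<and>
     (if ys = [] then T = 0 else hd ys = a + s * (N + 2))"

lemma growth_trans:
  assumes "growth X H E 1 a s N T ys cs" "growth X' H' E' e (front_base a s N T) (front_dir s T) (N + T) T' ys' cs'"
    and "0 \<le> T" "0 \<le> T'"
  shows "growth (X + X') (H + H') (E + E') e a s N (T + T') (ys @ ys') (cs @ cs')"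
proof -
  have l: "last ((a + s) # ys) = front_base a s N T + front_dir s T" using assms(1) by (simp add: growth_def)
  let ?a = "front_base a s N T" and ?s = "front_dir s T"
  have lst: "last ((a + s) # ys @ ys') = last ((?a + ?s) # ys')"
    using l by (cases ys') auto
  have D1: "path_diffs ((a + s) # ys) + cycles_diffs cs + H = mset_set {N + 1..N + T} + E"
    and D2: "path_diffs ((?a + ?s) # ys') + cycles_diffs cs' + H' = mset_set {N + T + 1..N + T + T'} + E'"
    and V1: "mset ys + mset (concat cs) + interval a s N = interval ?a ?s (N + T) + X"
    and V2: "mset ys' + mset (concat cs') + interval ?a ?s (N + T) =
      interval (front_base a s N (T + T')) (front_dir s (T + T')) (N + (T + T')) + X'"
    using assms(1,2) unfolding growth_def front_base_trans front_dir_trans by (simp_all only: add.assoc)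
  have "path_diffs ((a + s) # ys @ ys') = path_diffs ((a + s) # ys) + path_diffs ((?a + ?s) # ys')"
    using path_diffs_append_Cons[of "(a + s) # ys" ys'] l by simp
  then have "path_diffs ((a + s) # ys @ ys') + cycles_diffs (cs @ cs') + (H + H') =
      (path_diffs ((a + s) # ys) + cycles_diffs cs + H) + (path_diffs ((?a + ?s) # ys') + cycles_diffs cs' + H')"
    by (simp add: ac_simps)
  also have "\<dots> = mset_set {N + 1..N + T} + mset_set {N + T + 1..N + T + T'} + (E + E')"
    unfolding D1 D2 by (simp add: ac_simps)
  also have "mset_set {N + 1..N + T} + mset_set {N + T + 1..N + T + T'} = mset_set {N + 1..N + (T + T')}"
    using mset_interval_join[of N "N + T" "N + T + T'"] assms by (simp add: algebra_simps)
  finally have D: "path_diffs ((a + s) # ys @ ys') + cycles_diffs (cs @ cs') + (H + H') =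
      mset_set {N + 1..N + (T + T')} + (E + E')" .
  have "mset (ys @ ys') + mset (concat (cs @ cs')) + interval a s N =
      mset ys' + mset (concat cs') + (mset ys + mset (concat cs) + interval a s N)"
    by (simp add: ac_simps)
  also have "\<dots> = (mset ys' + mset (concat cs') + interval ?a ?s (N + T)) + X"
    unfolding V1 by (simp add: ac_simps)
  finally have V: "mset (ys @ ys') + mset (concat (cs @ cs')) + interval a s N =
      interval (front_base a s N (T + T')) (front_dir s (T + T')) (N + (T + T')) + (X + X')"
    unfolding V2 by (simp add: ac_simps)
  have L: "last ((a + s) # ys @ ys') = front_base a s N (T + T') + e * front_dir s (T + T')"
    using assms(2) unfolding lst growth_def front_base_trans front_dir_trans by blast
  have hd: "if ys @ ys' = [] then T + T' = 0 else hd (ys @ ys') = a + s * (N + 2)"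
  proof (cases "ys = []")
    case True
    then have "T = 0" using assms(1) by (simp add: growth_def)
    then show ?thesis using assms(2) True by (simp add: growth_def front_base_def front_dir_def)
  next
    case False
    then show ?thesis using assms(1) by (simp add: growth_def)
  qed
  show ?thesis
    unfolding growth_def using D V L hd by blast
qed

lemma interval_front:
  assumes "\<bar>s\<bar> = 1"
  shows "interval (front_base a s N T) (front_dir s T) (N + T) = interval (a - s * (T div 2)) s (N + T)"
proof (cases "even T")
  case True
  then show ?thesis by (simp add: front_base_def front_dir_def)
next
  case False
  then obtain k where k: "T = 2 * k + 1" by (elim oddE)
  then have "(T + 1) div 2 = k + 1" "T div 2 = k" by auto
  then show ?thesis
    using assms False k by (simp add: front_base_def front_dir_def) (intro interval_flip, auto simp: algebra_simps)
qed

lemma mset_interval_list: "mset_set {k + 1..k + int n} = mset (map (\<lambda>i. k + int i) [1..<Suc n])"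
proof (induction n)
  case (Suc n)
  have "{k + 1..k + int (Suc n)} = insert (k + int (Suc n)) {k + 1..k + int n}" by auto
  then show ?case using Suc by simp
qed simp

lemma mset_interval_adj:
  "j = m + 1 \<Longrightarrow> k \<le> j \<Longrightarrow> m \<le> n \<Longrightarrow> mset_set {k..m} + mset_set {j..n} = mset_set {k..n::int}"
  by (subst mset_set_Union[symmetric]) (auto intro!: arg_cong[of _ _ mset_set])

lemma unit_cases:
  assumes "\<bar>s::int\<bar> = 1"
  obtains "s = 1" | "s = -1"
  using assms by linarith

lemma upt_small: "[Suc 0..<2] = [1]" "[Suc 0..<3] = [1,2]" "[Suc 0..<4] = [1,2,3]" "[Suc 0..<5] = [1,2,3,4]"
  by (simp_all add: upt_rec)

lemma mset_interval_small:
  "mset_set {N + 1..N + 2::int} = {#N + 1, N + 2#}"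
  "mset_set {N + 1..N + 3::int} = {#N + 1, N + 2, N + 3#}"
  "mset_set {N + 1..N + 4::int} = {#N + 1, N + 2, N + 3, N + 4#}"
  using mset_interval_list[of N 2] mset_interval_list[of N 3] mset_interval_list[of N 4]
  by (simp_all add: upt_small)

lemma interval_front_grow:
  assumes "\<bar>s\<bar> = 1" "N \<ge> 0" "T div 2 = int i" "T - T div 2 = int j"
  shows "interval (front_base a s N T) (front_dir s T) (N + T) = interval a s N + mset (map (\<lambda>k. a - s * int k) [1..<Suc i]) +
    mset (map (\<lambda>k. a + s * (N + int k)) [1..<Suc j])"
proof -
  have "interval (front_base a s N T) (front_dir s T) (N + T) = interval (a - s * int i) s (N + int i + int j)"
    using assms interval_front[of s a N T] by (simp add: algebra_simps)
  then show ?thesis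
    using assms by (simp only: interval_grow)
qed

lemma interval_front_small:
  assumes "\<bar>s\<bar> = 1" "N \<ge> 0"
  shows "interval (front_base a s N 1) (front_dir s 1) (N + 1) = interval a s N + {#a + s * (N + 1)#}"
    and "interval (front_base a s N 3) (front_dir s 3) (N + 3) = interval a s N + {#a - s, a + s * (N + 1), a + s * (N + 2)#}"
    and "interval (front_base a s N 4) (front_dir s 4) (N + 4) =
      interval a s N + {#a - s, a - s * 2, a + s * (N + 1), a + s * (N + 2)#}"
    and "interval (front_base a s N 5) (front_dir s 5) (N + 5) =
      interval a s N + {#a - s, a - s * 2, a + s * (N + 1), a + s * (N + 2), a + s * (N + 3)#}"
  using assms interval_front_grow[of s N 1 0 1 a] interval_front_grow[of s N 3 1 2 a] interval_front_grow[of s N 4 2 2 a]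
    interval_front_grow[of s N 5 2 3 a]
  by (simp_all add: upt_small)

section \<open>Elementary growth steps\<close>

lemma growth_0: "growth {#} {#} {#} 1 a s N 0 [] []"
  by (simp add: growth_def front_base_def front_dir_def)

text \<open>The path uses the differences \<open>N + 1\<close>, \<open>N + 3\<close>,
  \<open>N + 2\<close> in this order; in \<open>growth_4\<close> they are \<open>N + 1\<close>,
  \<open>N + 4\<close>, \<open>N + 3\<close>, \<open>N + 2\<close>.\<close>

lemma growth_3:
  assumes "\<bar>s\<bar> = 1" "N \<ge> 0"
  shows "growth {#} {#} {#} 1 a s N 3 [a + s * (N + 2), a - s, a + s * (N + 1)] []"
  using assms(1)
  by (cases rule: unit_cases) (insert assms, simp_all add: growth_def interval_front_small mset_interval_small,
      simp_all add: front_base_def front_dir_def add.commute add_mset_commute)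

lemma growth_4:
  assumes "\<bar>s\<bar> = 1" "N \<ge> 0"
  shows "growth {#} {#} {#} 1 a s N 4 [a + s * (N + 2), a - s * 2, a + s * (N + 1), a - s] []"
  using assms(1)
  by (cases rule: unit_cases) (insert assms, simp_all add: growth_def interval_front_small mset_interval_small,
      simp_all add: front_base_def front_dir_def add.commute add_mset_commute)

text \<open>The edge opposite to \<open>z\<close> needs the difference \<open>N + 2\<close>, which longer odd cycles leave free
  (see \<open>open_growth_birth_odd\<close>). Leaving out \<open>N + 3\<close> instead forces the path to the very end
  of the interval.\<close>

lemma growth_triangle:
  assumes "\<bar>s\<bar> = 1" "N \<ge> 0"
  shows "growth {#z#} {#N + 3#} {#\<bar>z - (a - s)\<bar>, \<bar>z - (a + s * (N + 1))\<bar>#} 0 a s N 3 [a + s * (N + 2)]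
    [[a - s, z, a + s * (N + 1)]]"
  using assms(1)
  by (cases rule: unit_cases) (insert assms, simp_all add: growth_def interval_front_small mset_interval_small cycle_diffs_def,
      simp_all add: front_base_def front_dir_def abs_minus_commute add.commute add_mset_commute)

text \<open>A path that ends exactly at an end point can jump to a new vertex beyond the opposite
  end. This edge spans the whole new interval, and the path again ends at an end point.\<close>

lemma growth_zero_step:
  assumes "\<bar>s\<bar> = 1" "N \<ge> 0" "T \<ge> 0" and g: "growth X H E 0 a s N T ys cs" and "ys \<noteq> []"
  shows "\<exists>y. growth X H E 0 a s N (T + 1) (ys @ [y]) cs"
proof -
  let ?a = "front_base a s N T" and ?s = "front_dir s T"
  let ?y = "?a + ?s * (N + T + 1)"
  have s: "\<bar>?s\<bar> = 1" using assms by simp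
  have V: "interval (front_base a s N (T + 1)) (front_dir s (T + 1)) (N + (T + 1)) = interval ?a ?s (N + T) + {#?y#}"
    using interval_front_small(1)[of ?s "N + T" ?a] s assms by (simp add: front_base_trans front_dir_trans algebra_simps)
  have M: "mset_set {N + 1..N + (T + 1)} = add_mset (N + T + 1) (mset_set {N + 1..N + T})"
    using mset_interval_join[of N "N + T" "N + T + 1"] assms by (simp add: add.assoc)
  have "\<bar>?a - ?y\<bar> = N + T + 1"
    using s by (cases rule: unit_cases) (use assms in simp_all)
  moreover have "last ((a + s) # ys) = ?a" using g unfolding growth_def by simp
  ultimately have P: "path_diffs ((a + s) # ys @ [?y]) = add_mset (N + T + 1) (path_diffs ((a + s) # ys))"
    using path_diffs_append[of "(a + s) # ys" "[?y]"] by simp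
  have L: "front_base a s N (T + 1) = ?y"
    using front_base_trans[of a s N T 1] by (simp add: front_base_def[of ?a ?s "N + T" 1] algebra_simps)
  have "growth X H E 0 a s N (T + 1) (ys @ [?y]) cs"
    using g assms(5) unfolding growth_def V M P by (simp add: L)
  then show ?thesis by blast
qed

lemma growth_zero_steps:
  assumes "\<bar>s\<bar> = 1" "N \<ge> 0" "T \<ge> 0" and g: "growth X H E 0 a s N T ys cs" and "ys \<noteq> []"
  shows "\<exists>ys'. growth X H E 0 a s N (T + int n) ys' cs \<and> ys' \<noteq> []"
proof (induction n)
  case (Suc n)
  then obtain ys' where "growth X H E 0 a s N (T + int n) ys' cs" "ys' \<noteq> []" by blast
  with growth_zero_step[OF assms(1,2) _ this] assms(3) show ?case
    by (auto simp: add.assoc add.commute[of 1])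
qed (use assms in auto)

text \<open>As \<open>growth\<close>, but with a single new cycle that is still open. The ends of its fragment \<open>fr\<close> are
  the end points of the interval, so that closing it uses the difference \<open>N + T\<close>.\<close>

definition open_growth where
  "open_growth X H E y a s N T ys fr \<longleftrightarrow>
     mset ys + mset fr + interval a s N = interval (front_base a s N T) (front_dir s T) (N + T) + X \<and>
     path_diffs ((a + s) # ys) + path_diffs fr + H = mset_set {N + 1..N + (T - 1)} + E \<and>
     last ((a + s) # ys) = front_base a s N T + front_dir s T \<and>
     ys \<noteq> [] \<and> hd ys = y \<and>
     fr \<noteq> [] \<and> hd fr = front_base a s N T \<and> last fr = front_base a s N T + front_dir s T * (N + T)"

text \<open>The path takes \<open>N + 1\<close> and the fragment takes \<open>N + 4\<close>,
  \<open>N + 2\<close>, \<open>N + 3\<close>, which leaves \<open>N + 5\<close> for closing the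
  cycle.\<close>

lemma open_growth_birth:
  assumes "\<bar>s\<bar> = 1" "N \<ge> 0"
  shows "open_growth {#} {#} {#} (a + s * (N + 2)) a s N 5 [a + s * (N + 2)]
    [a + s * (N + 3), a - s, a + s * (N + 1), a - s * 2]"
  using assms(1)
  by (cases rule: unit_cases) (insert assms, simp_all add: open_growth_def interval_front_small mset_interval_small,
      simp_all add: front_base_def front_dir_def add.commute add_mset_commute)

text \<open>This is \<open>open_growth_birth\<close> with \<open>z\<close> inserted into the edge of
  difference \<open>N + 2\<close>.\<close>

lemma open_growth_birth_odd:
  assumes "\<bar>s\<bar> = 1" "N \<ge> 0"
  shows "open_growth {#z#} {#N + 2#} {#\<bar>z - (a - s)\<bar>, \<bar>z - (a + s * (N + 1))\<bar>#} (a + s * (N + 2)) a s N 5 [a + s * (N + 2)]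
    [a + s * (N + 3), a - s, z, a + s * (N + 1), a - s * 2]"
  using assms(1)
  by (cases rule: unit_cases) (insert assms, simp_all add: open_growth_def interval_front_small mset_interval_small,
      simp_all add: front_base_def front_dir_def abs_minus_commute add.commute add_mset_commute)

text \<open>The path takes the difference \<open>N + T\<close> that had been kept for closing the
  cycle, the two ends of the fragment take \<open>N + T + 1\<close> and \<open>N + T + 2\<close>,
  and \<open>N + T + 3\<close> is now kept for closing.\<close>

lemma open_growth_step:
  assumes "\<bar>s\<bar> = 1" "N \<ge> 0" "T \<ge> 1" and t: "open_growth X H E y a s N T ys fr"
  shows "\<exists>ys' fr'. open_growth X H E y a s N (T + 3) ys' fr' \<and> length fr' = length fr + 2"
proof -
  let ?a = "front_base a s N T" and ?s = "front_dir s T"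
  let ?N = "N + T"
  let ?y = "?a + ?s * (?N + 1)"
  let ?fr = "(?a + ?s * (?N + 2)) # fr @ [?a - ?s]"
  have s: "\<bar>?s\<bar> = 1" using assms by simp
  have V: "interval (front_base a s N (T + 3)) (front_dir s (T + 3)) (N + (T + 3)) =
      interval ?a ?s ?N + {#?a - ?s, ?y, ?a + ?s * (?N + 2)#}"
    using interval_front_small(2)[of ?s ?N ?a] s assms by (simp add: front_base_trans front_dir_trans algebra_simps)
  have M: "mset_set {N + 1..N + (T + 3 - 1)} = mset_set {N + 1..N + (T - 1)} + {#?N, ?N + 1, ?N + 2#}"
    using mset_interval_join[of N "?N - 1" "?N + 2"] mset_interval_small(2)[of "?N - 1"] assms
    by (simp add: algebra_simps)
  have a: "\<bar>?a + ?s - ?y\<bar> = ?N" "\<bar>?a + ?s * (?N + 2) - ?a\<bar> = ?N + 2" "\<bar>?a + ?s * ?N - (?a - ?s)\<bar> = ?N + 1"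
    using s by (cases rule: unit_cases; use assms in simp)+
  have P: "path_diffs ((a + s) # ys @ [?y]) = add_mset ?N (path_diffs ((a + s) # ys))"
  proof -
    have "path_diffs (((a + s) # ys) @ [?y]) = path_diffs ((a + s) # ys) + add_mset \<bar>last ((a + s) # ys) - hd [?y]\<bar> (path_diffs [?y])"
      by (rule path_diffs_append) simp_all
    moreover have "last ((a + s) # ys) = ?a + ?s" using t unfolding open_growth_def by blast
    ultimately have "path_diffs (((a + s) # ys) @ [?y]) = path_diffs ((a + s) # ys) + add_mset \<bar>?a + ?s - ?y\<bar> (path_diffs [?y])"
      by (simp only: list.sel)
    then show ?thesis unfolding a(1) by simp
  qed
  have F: "path_diffs ?fr = path_diffs fr + {#?N + 1, ?N + 2#}"
  proof -
    have h: "fr \<noteq> []" "hd fr = ?a" "last fr = ?a + ?s * ?N"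
      using t unfolding open_growth_def by blast+
    from h(1) have "path_diffs ?fr = add_mset \<bar>?a + ?s * (?N + 2) - hd fr\<bar> (add_mset \<bar>last fr - (?a - ?s)\<bar> (path_diffs fr))"
      by (simp add: path_diffs_Cons path_diffs_append)
    then show ?thesis unfolding h(2,3) a(2,3) by simp
  qed
  have sh: "front_base a s N (T + 3) = ?a + ?s * (?N + 2)" "front_dir s (T + 3) = - ?s"
    using front_base_trans[of a s N T 3] front_dir_trans[of s T 3]
    by (simp_all add: front_base_def[of ?a ?s "N + T" 3] front_dir_def[of ?s 3] algebra_simps)
  have "open_growth X H E y a s N (T + 3) (ys @ [?y]) ?fr"
    using t unfolding open_growth_def V M P F by (simp add: sh algebra_simps)
  then show ?thesis by (intro exI conjI) auto
qed

lemma open_growth_steps: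
  assumes "\<bar>s\<bar> = 1" "N \<ge> 0" "T \<ge> 1" and t: "open_growth X H E y a s N T ys fr"
  shows "\<exists>ys' fr'. open_growth X H E y a s N (T + 3 * int n) ys' fr' \<and> length fr' = length fr + 2 * n"
proof (induction n)
  case (Suc n)
  then obtain ys' fr' where *: "open_growth X H E y a s N (T + 3 * int n) ys' fr'" "length fr' = length fr + 2 * n"
    by blast
  from open_growth_step[OF assms(1,2) _ *(1)] assms(3) *(2) show ?case
    by (auto simp: algebra_simps)
qed (use assms in auto)

text \<open>The first vertex \<open>y\<close> stays arbitrary, because
  \<open>end_labeling_base_odd\<close> starts with a vertex other than
  \<open>a + s * (N + 2)\<close>.\<close>

lemma open_growth_close_diff:
  assumes "\<bar>s\<bar> = 1" "N \<ge> 0" "T \<ge> 1" and t: "open_growth X H E y a s N T ys fr"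
  shows "path_diffs ((a + s) # ys) + cycle_diffs fr + H = mset_set {N + 1..N + T} + E"
proof -
  have "\<bar>front_dir s T\<bar> = 1" using assms by simp
  then have "\<bar>last fr - hd fr\<bar> = N + T"
    using t by (cases rule: unit_cases) (use assms in \<open>simp_all add: open_growth_def\<close>)
  moreover have "mset_set {N + 1..N + T} = add_mset (N + T) (mset_set {N + 1..N + (T - 1)})"
    using mset_interval_Suc[of "N + 1" "N + T - 1"] assms by (cases "T = 1") (simp_all add: algebra_simps)
  ultimately show ?thesis
    using t unfolding open_growth_def by (auto simp: cycle_diffs_def)
qed

lemma open_growth_close:
  assumes "\<bar>s\<bar> = 1" "N \<ge> 0" "T \<ge> 1" and t: "open_growth X H E (a + s * (N + 2)) a s N T ys fr"
  shows "growth X H E 1 a s N T ys [fr]"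
  using open_growth_close_diff[OF assms] t unfolding open_growth_def growth_def by auto

lemma growth_even_cycle:
  assumes "\<bar>s\<bar> = 1" "N \<ge> 0" "even l" "l \<ge> 4"
  shows "\<exists>ys c. growth {#} {#} {#} 1 a s N (int (3 * (l div 2) - 1)) ys [c] \<and> length c = l"
proof -
  from assms obtain k where k: "l = 2 * k + 4"
    by (metis add.commute dvd_add_right_iff even_numeral evenE le_Suc_ex)
  from open_growth_steps[OF assms(1,2) _ open_growth_birth[OF assms(1,2), where a = a], of k] obtain ys fr where
    "open_growth {#} {#} {#} (a + s * (N + 2)) a s N (5 + 3 * int k) ys fr" "length fr = l"
    using k by auto
  from open_growth_close[OF assms(1,2) _ this(1)] this(2) k show ?thesis
    by (auto simp: algebra_simps)
qed

section \<open>Filling up to a prescribed size\<close>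

definition fillable :: "nat \<Rightarrow> bool" where
  "fillable n \<longleftrightarrow> (\<exists>i j. n = 3 * i + 4 * j)"

text \<open>The largest number not of this form is 5: the cases 6, 7 and 8 are direct, and the
  others follow by adding 3.\<close>

lemma fillable_ge: "n \<ge> 6 \<Longrightarrow> fillable n"
proof (induction n rule: less_induct)
  case (less n)
  show ?case
  proof (cases "n \<ge> 9")
    case True
    then have "fillable (n - 3)" by (intro less.IH) auto
    then obtain i j where "n - 3 = 3 * i + 4 * j" by (auto simp: fillable_def)
    then have "n = 3 * Suc i + 4 * j" using True by simp
    then show ?thesis unfolding fillable_def by blast
  next
    case False
    with less.prems have "n = 3 * 2 + 4 * 0 \<or> n = 3 * 1 + 4 * 1 \<or> n = 3 * 0 + 4 * 2" by arith
    then show ?thesis unfolding fillable_def by blast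
  qed
qed

lemma growth_fill:
  assumes "\<bar>s\<bar> = 1" "N \<ge> 0"
  shows "fillable n \<Longrightarrow> \<exists>ys. growth {#} {#} {#} 1 a s N (int n) ys []"
proof -
  have "\<exists>ys. growth {#} {#} {#} 1 a s N (int (3 * i + 4 * j)) ys []" for i j
  proof (induction j)
    case 0
    show ?case
    proof (induction i)
      case 0
      show ?case using growth_0 by auto
    next
      case (Suc i)
      then obtain ys where "growth {#} {#} {#} 1 a s N (int (3 * i + 4 * 0)) ys []" by blast
      from growth_trans[OF this growth_3] assms show ?case by (auto simp: algebra_simps)
    qed
  next
    case (Suc j)
    then obtain ys where "growth {#} {#} {#} 1 a s N (int (3 * i + 4 * j)) ys []" by blast
    from growth_trans[OF this growth_4] assms show ?case by (auto simp: algebra_simps)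
  qed
  then show "fillable n \<Longrightarrow> ?thesis" by (auto simp: fillable_def)
qed

definition evens_size :: "nat list \<Rightarrow> nat" where
  "evens_size ls = (\<Sum>l\<leftarrow>ls. 3 * (l div 2) - 1)"

lemma growth_evens:
  assumes "\<bar>s\<bar> = 1" "N \<ge> 0" "\<forall>l\<in>set ls. even l \<and> l \<ge> 4"
  shows "\<exists>ys cs. growth {#} {#} {#} 1 a s N (int (evens_size ls)) ys cs \<and> map length cs = ls"
  using assms(3)
proof (induction ls rule: rev_induct)
  case Nil
  show ?case using growth_0 by (auto simp: evens_size_def)
next
  case (snoc l ls)
  then obtain ys cs where *: "growth {#} {#} {#} 1 a s N (int (evens_size ls)) ys cs" "map length cs = ls" by auto
  obtain ys' c where c: "length c = l"
    "growth {#} {#} {#} 1 (front_base a s N (int (evens_size ls))) (front_dir s (int (evens_size ls))) (N + int (evens_size ls)) (int (3 * (l div 2) - 1)) ys' [c]"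
    using growth_even_cycle[of "front_dir s (int (evens_size ls))" "N + int (evens_size ls)" l "front_base a s N (int (evens_size ls))"]
      snoc.prems assms by fastforce
  have "growth {#} {#} {#} 1 a s N (int (evens_size (ls @ [l]))) (ys @ ys') (cs @ [c])"
    using growth_trans[OF *(1) c(2)] by (simp add: evens_size_def)
  then show ?case using c(1) *(2) by (intro exI conjI) auto
qed

lemma growth_evens_fill:
  assumes "\<bar>s\<bar> = 1" "N \<ge> 0" "\<forall>l\<in>set ls. even l \<and> l \<ge> 4" "n \<ge> evens_size ls + 6"
  shows "\<exists>ys cs. growth {#} {#} {#} 1 a s N (int n) ys cs \<and> map length cs = ls"
proof -
  obtain ys cs where 1: "growth {#} {#} {#} 1 a s N (int (evens_size ls)) ys cs" "map length cs = ls"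
    using growth_evens[OF assms(1-3)] by blast
  have "fillable (n - evens_size ls)" using assms by (intro fillable_ge) auto
  then obtain ys' where 2: "growth {#} {#} {#} 1 (front_base a s N (int (evens_size ls))) (front_dir s (int (evens_size ls)))
     (N + int (evens_size ls)) (int (n - evens_size ls)) ys' []"
    using growth_fill[of "front_dir s (int (evens_size ls))" "N + int (evens_size ls)" "n - evens_size ls" "front_base a s N (int (evens_size ls))"]
      assms by fastforce
  have "int (evens_size ls) + int (n - evens_size ls) = int n" using assms by simp
  then have "growth {#} {#} {#} 1 a s N (int n) (ys @ ys') cs"
    using growth_trans[OF 1(1) 2] by simp
  then show ?thesis using 1(2) by blast
qed

lemma growth_odd_fill:
  assumes s: "\<bar>s\<bar> = 1" and N: "N \<ge> 0" and l: "odd l" "l \<ge> 3" and n: "2 * n \<ge> 3 * l + 7"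
  defines "e \<equiv> (if l = 3 then 0 else 1)"
  shows "\<exists>ys c. growth {#z#} {#N + 3 - e#} {#\<bar>z - (a - s)\<bar>, \<bar>z - (a + s * (N + 1))\<bar>#} e a s N (int n) ys [c]
    \<and> length c = l"
proof (cases "l = 3")
  case True
  have "n \<ge> 3" using n True by simp
  then have "3 + int (n - 3) = int n" by simp
  with growth_zero_steps[OF s N _ growth_triangle[OF s N, where a = a and z = z], of "n - 3"] obtain ys where
    "growth {#z#} {#N + 3#} {#\<bar>z - (a - s)\<bar>, \<bar>z - (a + s * (N + 1))\<bar>#} 0 a s N (int n) ys
      [[a - s, z, a + s * (N + 1)]]"
    by auto
  moreover have "length [a - s, z, a + s * (N + 1)] = l" using True by simp
  ultimately show ?thesis unfolding e_def if_P[OF True] diff_0_right by blast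
next
  case False
  obtain k where k: "l = 2 * k + 5"
  proof -
    from l obtain j where "l = 2 * j + 1" by (elim oddE)
    then show ?thesis using l False that[of "j - 2"] by auto
  qed
  let ?E = "{#\<bar>z - (a - s)\<bar>, \<bar>z - (a + s * (N + 1))\<bar>#}"
  from open_growth_steps[OF s N _ open_growth_birth_odd[OF s N, where a = a and z = z], of k] obtain ys fr where
    t: "open_growth {#z#} {#N + 2#} ?E (a + s * (N + 2)) a s N (5 + 3 * int k) ys fr" "length fr = l"
    using k by auto
  from open_growth_close[OF s N _ t(1)] have 1: "growth {#z#} {#N + 2#} ?E 1 a s N (5 + 3 * int k) ys [fr]"
    by simp
  have "fillable (n - (5 + 3 * k))" using n k by (intro fillable_ge) auto
  then obtain ys' where "growth {#} {#} {#} 1 (front_base a s N (5 + 3 * int k)) (front_dir s (5 + 3 * int k))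
     (N + (5 + 3 * int k)) (int (n - (5 + 3 * k))) ys' []"
    using growth_fill[of "front_dir s (5 + 3 * int k)" "N + (5 + 3 * int k)" "n - (5 + 3 * k)"
      "front_base a s N (5 + 3 * int k)"] s N by fastforce
  from growth_trans[OF 1 this] have "growth {#z#} {#N + 2#} ?E 1 a s N (int n) (ys @ ys') [fr]"
    using n k by simp
  moreover have "e = 1" "N + 3 - e = N + 2" using False by (simp_all add: e_def)
  ultimately show ?thesis using t(2) by metis
qed

lemma image_sub_interval: "image_mset (\<lambda>x. k - x) (mset_set {m..n}) = mset_set {k - n..k - m::int}"
  by (subst image_mset_mset_set) (auto simp: inj_on_def)

lemma interval_widen:
  assumes "\<bar>s\<bar> = 1" "N \<ge> 0"
  shows "interval (a - s * int p) s (N + 2 * int p) = interval a s N +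
    image_mset (\<lambda>z. a + s * z) (mset_set {- int p..-1}) +
    image_mset (\<lambda>z. a + s * N + s * z) (mset_set {1..int p})"
proof -
  have "mset_set {- int p..-1} = image_mset uminus (mset_set {1..int p})"
    by (subst image_mset_mset_set) auto
  then show ?thesis
    using interval_grow[OF assms, of a p p] mset_interval_list[of 0 p]
    by (simp add: image_mset.compositionality comp_def algebra_simps del: mset_map flip: mset_map)
qed

section \<open>Extending the path alone\<close>

text \<open>A nonzero integer \<open>z\<close> stands for the vertex at distance \<open>\<bar>z\<bar>\<close> beyond the interval, on the far
  side if \<open>z > 0\<close> and beyond \<open>a\<close> if \<open>z < 0\<close>. Thus an edge joining the two sides has
  difference \<open>N\<close> more than the difference of its codes.\<close>

definition lift :: "int \<Rightarrow> int \<Rightarrow> int \<Rightarrow> int \<Rightarrow> int" where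
  "lift a s N z = (if z > 0 then a + s * N + s * z else a + s * z)"

lemma path_diffs_lift:
  assumes "\<bar>s\<bar> = 1" "N \<ge> 0" "successively (\<lambda>x y. x * y < 0) xs"
  shows "path_diffs (map (lift a s N) xs) = image_mset (\<lambda>d. N + d) (path_diffs xs)"
  using assms(3)
proof (induction xs rule: path_diffs.induct)
  case (3 x y zs)
  then have "x > 0 \<and> y < 0 \<or> x < 0 \<and> y > 0" by (auto simp: mult_less_0_iff)
  then have "\<bar>lift a s N x - lift a s N y\<bar> = N + \<bar>x - y\<bar>"
    using assms(1,2) unfolding lift_def by (auto simp: abs_if split: if_splits)
  then show ?case using 3 by simp
qed auto

section \<open>Alternating paths in a window\<close>

definition window :: "nat \<Rightarrow> nat \<Rightarrow> int multiset" where
  "window p q = mset_set {- int p..-1} + mset_set {1..int q}"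

text \<open>Both runs are zigzags towards 0 whose differences decrease by one at each edge, down to
  2. \<open>runA\<close> covers equally many codes on both sides and ends at -1; \<open>runB\<close>
  has one more positive code and ends at 1.\<close>

fun runA :: "nat \<Rightarrow> int list" where
  "runA 0 = [1, -1]"
| "runA (Suc n) = (int n + 2) # (- (int n + 2)) # runA n"

fun runB :: "nat \<Rightarrow> int list" where
  "runB 0 = [1]"
| "runB (Suc n) = (int n + 2) # (- (int n + 1)) # runB n"

lemma hd_runs [simp]: "hd (runA n) = int n + 1" "hd (runB n) = int n + 1"
  by (induction n) auto

lemma last_runs [simp]: "last (runA n) = -1" "last (runB n) = 1"
  "runA n \<noteq> []" "runB n \<noteq> []"
  by (induction n) auto

lemma successively_Cons_hd:
  "xs \<noteq> [] \<Longrightarrow> successively P (x # xs) \<longleftrightarrow> P x (hd xs) \<and> successively P xs"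
  by (cases xs) auto

lemma successively_runs: "successively (\<lambda>x y. x * y < 0) (runA n)" "successively (\<lambda>x y. x * y < 0) (runB n)"
  by (induction n) (auto simp: successively_Cons_hd mult_less_0_iff)

lemma successively_sign_map:
  assumes "successively (\<lambda>x y. x * y < 0) xs" "\<bar>c::int\<bar> = 1" "\<And>x. x \<in> set xs \<Longrightarrow> sgn (f x) = c * sgn (x::int)"
  shows "successively (\<lambda>x y. x * y < 0) (map f xs)"
  unfolding successively_map
proof (rule successively_mono[OF assms(1)])
  fix x y assume xy: "x \<in> set xs" "y \<in> set xs" "x * y < 0"
  have "sgn (f x * f y) = c * c * sgn (x * y)"
    using assms(3)[OF xy(1)] assms(3)[OF xy(2)] by (simp add: sgn_mult)
  also have "\<dots> = -1" using assms(2) xy(3) by (auto simp: abs_if split: if_splits)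
  finally show "f x * f y < 0" by (metis sgn_less neg_less_0_iff_less zero_less_one)
qed

lemma window_Suc1: "window (Suc p) q = add_mset (- int (Suc p)) (window p q)"
proof -
  have "{- int (Suc p)..-1} = insert (- int (Suc p)) {- int p..-1}" by auto
  then show ?thesis by (simp add: window_def)
qed

lemma window_Suc2: "window p (Suc q) = add_mset (int (Suc q)) (window p q)"
proof -
  have "{1..int (Suc q)} = insert (int (Suc q)) {1..int q}" by auto
  then show ?thesis by (simp add: window_def)
qed

lemma mset_runs: "mset (runA n) = window (Suc n) (Suc n)" "mset (runB n) = window n (Suc n)"
proof (induction n)
  case 0
  { case 1 show ?case by (simp add: window_Suc1 window_Suc2) (simp add: window_def) }
  { case 2 show ?case by (simp add: window_Suc1 window_Suc2) (simp add: window_def) }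
next
  case (Suc n)
  { case 1 show ?case using Suc(1) by (simp add: window_Suc1[of "Suc n"] window_Suc2[of _ "Suc n"] add_mset_commute algebra_simps) }
  { case 2 show ?case using Suc(2) by (simp add: window_Suc1[of n] window_Suc2[of _ "Suc n"] add_mset_commute algebra_simps) }
qed

lemma path_diffs_runs: "path_diffs (runA n) = mset_set {2..2 * int n + 2}" "path_diffs (runB n) = mset_set {2..2 * int n + 1}"
proof (induction n)
  case 0
  { case 1 show ?case by simp }
  { case 2 show ?case by simp }
next
  case (Suc n)
  have "{2..2 * int n + 4} = insert (2 * int n + 4) (insert (2 * int n + 3) {2..2 * int n + 2})"
    "{2..2 * int n + 3} = insert (2 * int n + 3) (insert (2 * int n + 2) {2..2 * int n + 1})"
    by auto
  note * = this
  { case 1 show ?case using Suc(1) * by (simp add: path_diffs_Cons algebra_simps) }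
  { case 2 show ?case using Suc(2) * by (simp add: path_diffs_Cons algebra_simps) }
qed

text \<open>Difference 1 is left for the edge from the old path to the first code \<open>u\<close>.
  The last code lies at distance \<open>u - 1\<close> from the end \<open>- p\<close> of the window,
  the same distance that the old path end has in \<open>path_extension\<close>.\<close>

definition alternating_path :: "nat \<Rightarrow> nat \<Rightarrow> int list \<Rightarrow> bool" where
  "alternating_path p u xs \<longleftrightarrow> xs \<noteq> [] \<and> hd xs = int u \<and> last xs = int u - int p - 1 \<and> mset xs = window p p \<and>
     successively (\<lambda>x y. x * y < 0) xs \<and> path_diffs xs = mset_set {2..2 * int p}"

lemma image_add_interval: "image_mset (\<lambda>d. k + d) (mset_set {m..n}) = mset_set {k + m..k + n::int}"
  by (subst image_mset_mset_set) auto

lemma image_lift_window: "image_mset (lift a s N) (window p q) =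
    image_mset (\<lambda>z. a + s * z) (mset_set {- int p..-1}) + image_mset (\<lambda>z. a + s * N + s * z) (mset_set {1..int q})"
  unfolding window_def lift_def by (auto intro!: arg_cong2[of _ _ _ _ "(+)"] image_mset_cong)

text \<open>The codes of an inner window, together with 0, form an interval from \<open>- c\<close>
  to \<open>d\<close>. Coding the vertices around this interval again gives the outer part of a
  larger window.\<close>

lemma window_add_lift:
  assumes "a = - int c"
  shows "window c d + image_mset (lift a 1 (int c + int d)) (window p q) = window (c + p) (d + q)"
proof -
  have "image_mset (\<lambda>z. a + z) (mset_set {- int p..-1}) = mset_set {- int (c + p)..- int c - 1}"
    using assms by (subst image_add_interval) auto
  moreover have "image_mset (\<lambda>z. int d + z) (mset_set {1..int q}) = mset_set {int d + 1..int (d + q)}"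
    by (subst image_add_interval) (auto simp: add.commute)
  moreover have "mset_set {- int (c + p)..- int c - 1} + mset_set {- int c..-1} = mset_set {- int (c + p)..-1}"
    by (rule mset_interval_adj) auto
  moreover have "mset_set {1..int d} + mset_set {int d + 1..int (d + q)} = mset_set {1..int (d + q)}"
    by (rule mset_interval_adj) auto
  ultimately show ?thesis
    using assms by (simp add: image_lift_window) (simp add: window_def ac_simps)
qed

lemma window_add_lift_neg:
  "window n (Suc n) + image_mset (lift (int n + 1) (-1) (2 * int n + 1)) (window n (Suc n)) = window (2 * n + 1) (2 * n + 1)"
proof -
  have 1: "image_mset (\<lambda>z. int n + 1 + -1 * z) (mset_set {- int n..-1}) = mset_set {int n + 2..2 * int n + 1}"
    using image_sub_interval[of "int n + 1" "- int n" "-1"] by simp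
  have 2: "image_mset (\<lambda>z. int n + 1 + -1 * (2 * int n + 1) + -1 * z) (mset_set {1..int (Suc n)}) =
      mset_set {- int (2 * n + 1)..- int n - 1}"
    using image_sub_interval[of "- int n" 1 "int (Suc n)"] by simp
  have 3: "mset_set {- int (2 * n + 1)..- int n - 1} + mset_set {- int n..-1} = mset_set {- int (2 * n + 1)..-1}"
    by (rule mset_interval_adj) auto
  have 4: "mset_set {1..int (Suc n)} + mset_set {int n + 2..2 * int n + 1} = mset_set {1..int (2 * n + 1)}"
    using mset_interval_adj[of "int n + 2" "int (Suc n)" 1 "2 * int n + 1"] by simp
  show ?thesis
    unfolding image_lift_window 1 2 unfolding window_def 3[symmetric] 4[symmetric] by (simp only: ac_simps)
qed

lemma path_diffs_compl:
  assumes "set xs \<subseteq> {- p..-1} \<union> {1..p}" "successively (\<lambda>x y. x * y < 0) xs"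
  shows "path_diffs (map (\<lambda>z. if z > 0 then p + 1 - z else - (p + 1) - z) xs) = image_mset (\<lambda>d. 2 * p + 2 - d) (path_diffs xs)"
  using assms
proof (induction xs rule: path_diffs.induct)
  case (3 x y zs)
  then have "x > 0 \<and> y < 0 \<and> x \<le> p \<and> y \<ge> -p \<or> x < 0 \<and> y > 0 \<and> y \<le> p \<and> x \<ge> -p" by (auto simp: mult_less_0_iff)
  then show ?case using 3 by (auto simp: abs_if)
qed auto

lemma set_window: "mset xs = window p q \<Longrightarrow> set xs = {- int p..-1} \<union> {1..int q}"
proof -
  assume "mset xs = window p q"
  then have "set_mset (mset xs) = set_mset (window p q)" by simp
  then show ?thesis by (simp add: window_def)
qed

text \<open>For codes of opposite signs the reflection turns a difference \<open>d\<close> into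
  \<open>2 * p + 2 - d\<close>, which permutes the range from 2 to \<open>2 * p\<close>. The last
  code \<open>u - p - 1\<close> becomes \<open>- u\<close>, as required for the start
  \<open>p + 1 - u\<close>.\<close>

lemma alternating_path_compl:
  assumes "alternating_path p u xs" "1 \<le> u" "u \<le> p"
  shows "alternating_path p (p + 1 - u) (map (\<lambda>z. if z > 0 then int p + 1 - z else - (int p + 1) - z) xs)"
proof -
  let ?f = "\<lambda>z. if z > 0 then int p + 1 - z else - (int p + 1) - z"
  have st: "set xs = {- int p..-1} \<union> {1..int p}" using assms by (intro set_window) (simp add: alternating_path_def)
  have "image_mset ?f (window p p) = image_mset (\<lambda>z. - (int p + 1) - z) (mset_set {- int p..-1}) +
      image_mset (\<lambda>z. int p + 1 - z) (mset_set {1..int p})"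
    unfolding window_def by (auto intro!: arg_cong2[of _ _ _ _ "(+)"] image_mset_cong)
  also have "image_mset (\<lambda>z. - (int p + 1) - z) (mset_set {- int p..-1}) = mset_set {- int p..-1}"
    by (subst image_sub_interval) (auto simp: algebra_simps)
  also have "image_mset (\<lambda>z. int p + 1 - z) (mset_set {1..int p}) = mset_set {1..int p}"
    by (subst image_sub_interval) (auto simp: algebra_simps)
  finally have V: "image_mset ?f (window p p) = window p p" by (simp add: window_def)
  have D: "image_mset (\<lambda>d. 2 * int p + 2 - d) (mset_set {2..2 * int p}) = mset_set {2..2 * int p}"
    by (subst image_sub_interval) (auto simp: algebra_simps)
  have "successively (\<lambda>x y. x * y < 0) (map ?f xs)"
    using assms(1) by (intro successively_sign_map[where c = 1]) (auto simp: alternating_path_def st)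
  then show ?thesis
    using assms path_diffs_compl[of xs "int p"] st V D unfolding alternating_path_def
    by (simp add: hd_map last_map of_nat_diff)
qed

text \<open>A Euclidean algorithm: a zigzag run from the starting vertex \<open>u\<close> inwards covers the window of
  radius about \<open>u\<close>, and jumping from its end to \<open>2u\<close> (or \<open>-(2u - 1)\<close>) leaves the same problem for
  the remaining smaller window. Reflecting each side of the window exchanges \<open>u\<close> and
  \<open>p + 1 - u\<close>, so one may assume \<open>2u \<le> p + 1\<close>.\<close>

lemma alternating_path_ex: "1 \<le> u \<Longrightarrow> u \<le> p \<Longrightarrow> \<exists>xs. alternating_path p u xs"
proof (induction p arbitrary: u rule: less_induct)
  case (less p)
  have small: "\<exists>xs. alternating_path p u xs" if u: "1 \<le> u" "2 * u \<le> p + 1" for u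
  proof (cases "2 * u = p + 1")
    case True
    obtain n where n: "u = Suc n" using u by (cases u) auto
    then have p: "p = 2 * n + 1" using True by simp
    let ?f = "lift (int n + 1) (-1) (2 * int n + 1)"
    let ?xs = "runB n @ map ?f (runB n)"
    have h: "?f (int n + 1) = - (2 * int n + 1)" "?f 1 = - int n - 1" by (simp_all add: lift_def)
    have D: "path_diffs (map ?f (runB n)) = mset_set {2 * int n + 3..4 * int n + 2}"
      using path_diffs_lift[of "-1" "2 * int n + 1" "runB n" "int n + 1"] successively_runs(2)[of n]
      by (simp add: path_diffs_runs image_add_interval)
    have "path_diffs ?xs = mset_set {2..2 * int n + 1} + (add_mset (2 * int n + 2) (mset_set {2 * int n + 3..4 * int n + 2}))"
      using path_diffs_append[of "runB n" "map ?f (runB n)"] D h by (simp add: path_diffs_runs hd_map)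
    also have "\<dots> = mset_set {2..4 * int n + 2}"
      using mset_interval_adj[of "2 * int n + 3" "2 * int n + 2" "2 * int n + 2" "4 * int n + 2"]
        mset_interval_adj[of "2 * int n + 2" "2 * int n + 1" 2 "4 * int n + 2"]
      by simp
    finally have P: "path_diffs ?xs = mset_set {2..2 * int p}" using p by (simp add: algebra_simps)
    have "successively (\<lambda>x y. x * y < 0) (map ?f (runB n))"
      by (intro successively_sign_map[OF successively_runs(2), where c = "-1"]) (auto simp: lift_def set_window[OF mset_runs(2)])
    then have S: "successively (\<lambda>x y. x * y < 0) ?xs"
      using h successively_runs(2)[of n] by (simp add: successively_append_iff hd_map mult_less_0_iff)
    have V: "mset ?xs = window p p" using window_add_lift_neg[of n] p by (simp add: mset_runs)
    have "alternating_path p u ?xs"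
      using P S V h n p by (simp add: alternating_path_def last_map)
    then show ?thesis by blast
  next
    case False
    obtain n where n: "u = Suc n" using u by (cases u) auto
    have "1 \<le> u" "u \<le> p - u" "p - u < p" using u False by auto
    then obtain ys where ys: "alternating_path (p - u) u ys" using less.IH by blast
    let ?f = "lift (- int u) 1 (2 * int u)"
    \<comment> \<open>The run uses the differences from 2 to \<open>2 * u\<close> and ends at -1;
      the lifted path starts at \<open>2 * u\<close>, so the jump has difference
      \<open>2 * u + 1\<close>.\<close>
    let ?xs = "runA n @ map ?f ys"
    have h: "hd (map ?f ys) = 2 * int u" "last (map ?f ys) = int u - int p - 1" "ys \<noteq> []"
      using ys u False by (auto simp: alternating_path_def hd_map last_map lift_def of_nat_diff)
    have D: "path_diffs (map ?f ys) = mset_set {2 * int u + 2..2 * int p}"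
      using path_diffs_lift[of 1 "2 * int u" ys "- int u"] ys u False
      by (simp add: alternating_path_def image_add_interval of_nat_diff)
    have "path_diffs ?xs = mset_set {2..2 * int u} + add_mset (2 * int u + 1) (mset_set {2 * int u + 2..2 * int p})"
    proof -
      have "path_diffs (runA n) = mset_set {2..2 * int u}" using n by (simp add: path_diffs_runs add.commute)
      then show ?thesis using path_diffs_append[of "runA n" "map ?f ys"] D h by simp
    qed
    also have "\<dots> = mset_set {2..2 * int p}"
      using mset_interval_adj[of "2 * int u + 2" "2 * int u + 1" "2 * int u + 1" "2 * int p"]
        mset_interval_adj[of "2 * int u + 1" "2 * int u" 2 "2 * int p"] u False
      by simp
    finally have P: "path_diffs ?xs = mset_set {2..2 * int p}" .
    have st: "set ys = {- int (p - u)..-1} \<union> {1..int (p - u)}" using ys by (intro set_window) (simp add: alternating_path_def)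
    have "successively (\<lambda>x y. x * y < 0) ys" using ys by (simp add: alternating_path_def)
    then have "successively (\<lambda>x y. x * y < 0) (map ?f ys)"
      by (rule successively_sign_map[where c = 1]) (auto simp: lift_def st)
    then have S: "successively (\<lambda>x y. x * y < 0) ?xs"
      using h u successively_runs(1)[of n] by (simp add: successively_append_iff mult_less_0_iff)
    have V: "mset ?xs = window p p"
      using window_add_lift[of "- int u" u u "p - u" "p - u"] ys n u False by (simp add: mset_runs alternating_path_def)
    have "alternating_path p u ?xs"
      using P S V h n by (simp add: alternating_path_def)
    then show ?thesis by blast
  qed
  show ?case
  proof (cases "2 * u \<le> p + 1")
    case True
    then show ?thesis using small less.prems by blast
  next
    case False
    then have "1 \<le> p + 1 - u" "2 * (p + 1 - u) \<le> p + 1" "p + 1 - u \<le> p" "p + 1 - (p + 1 - u) = u"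
      using less.prems by auto
    then show ?thesis using small alternating_path_compl by metis
  qed
qed

text \<open>The alternating path with \<open>u = e + 1\<close> is lifted. Whatever \<open>e\<close>
  is, its first vertex has distance \<open>N + 1\<close> from the old path end, and the new path
  ends at distance \<open>e\<close> from the new end point.\<close>

lemma path_extension:
  assumes "\<bar>s\<bar> = 1" "N \<ge> 0" "0 \<le> e" "e < int p"
  shows "\<exists>ys. ys \<noteq> [] \<and> mset ys + interval a s N = interval (a - s * int p) s (N + 2 * int p) \<and>
    path_diffs ((a + s * e) # ys) = mset_set {N + 1..N + 2 * int p} \<and> last ys = a - s * int p + s * e"
proof -
  have "1 \<le> nat e + 1" "nat e + 1 \<le> p" using assms by linarith+
  then obtain xs where xs: "alternating_path p (nat e + 1) xs" using alternating_path_ex by blast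
  let ?ys = "map (lift a s N) xs"
  have V: "mset ?ys + interval a s N = interval (a - s * int p) s (N + 2 * int p)"
  proof -
    have "mset ?ys = image_mset (lift a s N) (window p p)" using xs by (simp add: alternating_path_def)
    then show ?thesis unfolding image_lift_window interval_widen[OF assms(1,2)] by (simp only: ac_simps)
  qed
  have n: "xs \<noteq> []" "hd xs = e + 1" "last xs = e - int p"
    using xs assms by (simp_all add: alternating_path_def)
  have "\<bar>(a + s * e) - hd ?ys\<bar> = N + 1"
    using n assms by (auto simp: hd_map lift_def abs_if algebra_simps split: if_splits)
  then have "path_diffs ((a + s * e) # ?ys) = add_mset (N + 1) (path_diffs ?ys)"
    using n by (simp add: path_diffs_Cons)
  also have "path_diffs ?ys = mset_set {N + 2..N + 2 * int p}"
    using path_diffs_lift[of s N xs a] xs assms by (simp add: alternating_path_def image_add_interval)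
  also have "add_mset (N + 1) \<dots> = mset_set {N + 1..N + 2 * int p}"
    using mset_interval_adj[of "N + 2" "N + 1" "N + 1" "N + 2 * int p"] assms by simp
  finally have "path_diffs ((a + s * e) # ?ys) = mset_set {N + 1..N + 2 * int p}" .
  moreover have "last ?ys = a - s * int p + s * e"
  proof -
    have "last ?ys = lift a s N (e - int p)" using n by (simp add: last_map)
    then show ?thesis using assms by (simp add: lift_def algebra_simps)
  qed
  ultimately show ?thesis using V n by (intro exI[of _ ?ys]) auto
qed

section \<open>Labelings with a prescribed end of the path\<close>

text \<open>The flag \<open>t\<close> records the presence of a 2-cycle, whose two edges have difference 3.\<close>

definition diffs_upto :: "bool \<Rightarrow> int \<Rightarrow> int multiset" where
  "diffs_upto t N = (if t then {#1, 3, 3#} + mset_set {4..N} else mset_set {1..N})"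

lemma diffs_upto_join: "3 \<le> N \<Longrightarrow> N \<le> N' \<Longrightarrow> diffs_upto t N + mset_set {N + 1..N'} = diffs_upto t N'"
  using mset_interval_join[of 3 N N'] mset_interval_join[of 0 N N'] by (simp add: diffs_upto_def)

text \<open>The distance \<open>e\<close> decides how the labeling can continue: growth with cycles
  needs \<open>e = 1\<close>, while \<open>path_extension\<close> only needs enough new vertices.
  From \<open>N = 3\<close> on, the multisets with and without a 2-cycle grow in the same
  way.\<close>

definition end_labeling :: "bool \<Rightarrow> int \<Rightarrow> int \<Rightarrow> int \<Rightarrow> int \<Rightarrow> int list list \<Rightarrow> int list \<Rightarrow> bool" where
  "end_labeling t a s N e cs P \<longleftrightarrow> \<bar>s\<bar> = 1 \<and> 3 \<le> N \<and> 0 \<le> e \<and> P \<noteq> [] \<and> last P = a + s * e \<and>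
     mset P + mset (concat cs) = interval a s N \<and> path_diffs P + cycles_diffs cs = diffs_upto t N"

text \<open>With \<open>cs' = []\<close> the second conclusion says that all new differences belong
  to the path; this gives the claim on the path differences.\<close>

lemma end_labeling_grow:
  assumes "end_labeling t a s N 1 cs P" "growth {#} {#} {#} 1 a s N T ys cs'" "T \<ge> 0"
  shows "end_labeling t (front_base a s N T) (front_dir s T) (N + T) 1 (cs @ cs') (P @ ys)"
    and "path_diffs (P @ ys) + cycles_diffs cs' = path_diffs P + mset_set {N + 1..N + T}"
proof -
  have P: "P \<noteq> []" "last P = a + s" "\<bar>s\<bar> = 1" "3 \<le> N" using assms by (simp_all add: end_labeling_def)
  have path_diffs: "path_diffs (P @ ys) = path_diffs P + path_diffs ((a + s) # ys)" using P path_diffs_append_Cons[of P ys] by simp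
  have g: "mset ys + mset (concat cs') + interval a s N = interval (front_base a s N T) (front_dir s T) (N + T)"
    "path_diffs ((a + s) # ys) + cycles_diffs cs' = mset_set {N + 1..N + T}"
    "last ((a + s) # ys) = front_base a s N T + front_dir s T"
    using assms(2) by (simp_all add: growth_def)
  show D: "path_diffs (P @ ys) + cycles_diffs cs' = path_diffs P + mset_set {N + 1..N + T}"
    using g(2) unfolding path_diffs by (simp add: ac_simps)
  have V: "mset P + mset (concat cs) = interval a s N" "path_diffs P + cycles_diffs cs = diffs_upto t N"
    using assms(1) by (simp_all add: end_labeling_def)
  have "path_diffs (P @ ys) + cycles_diffs (cs @ cs') = (path_diffs (P @ ys) + cycles_diffs cs') + cycles_diffs cs" by (simp add: ac_simps)
  also have "\<dots> = (path_diffs P + cycles_diffs cs) + mset_set {N + 1..N + T}" unfolding D by (simp add: ac_simps)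
  also have "\<dots> = diffs_upto t (N + T)" using V P assms(3) by (simp add: diffs_upto_join)
  finally have 1: "path_diffs (P @ ys) + cycles_diffs (cs @ cs') = diffs_upto t (N + T)" .
  have "mset (P @ ys) + mset (concat (cs @ cs')) = mset ys + mset (concat cs') + (mset P + mset (concat cs))"
    by (simp add: ac_simps)
  then have 2: "mset (P @ ys) + mset (concat (cs @ cs')) = interval (front_base a s N T) (front_dir s T) (N + T)"
    unfolding V(1) g(1) .
  have "last (P @ ys) = last ((a + s) # ys)" using P by (cases ys) auto
  then show "end_labeling t (front_base a s N T) (front_dir s T) (N + T) 1 (cs @ cs') (P @ ys)"
    unfolding end_labeling_def using 1 2 P g(3) assms(3) by simp
qed

lemma end_labeling_extend:
  assumes "end_labeling t a s N e cs P" "e < int p"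
  shows "\<exists>P'. end_labeling t (a - s * int p) s (N + 2 * int p) e cs P' \<and>
    path_diffs P' = path_diffs P + mset_set {N + 1..N + 2 * int p}"
proof -
  have P: "P \<noteq> []" "last P = a + s * e" "\<bar>s\<bar> = 1" "3 \<le> N" "0 \<le> e"
    "mset P + mset (concat cs) = interval a s N" "path_diffs P + cycles_diffs cs = diffs_upto t N"
    using assms by (simp_all add: end_labeling_def)
  obtain ys where ys: "ys \<noteq> []" "mset ys + interval a s N = interval (a - s * int p) s (N + 2 * int p)"
    "path_diffs ((a + s * e) # ys) = mset_set {N + 1..N + 2 * int p}" "last ys = a - s * int p + s * e"
    using path_extension[of s N e p a] P assms(2) by auto
  have D: "path_diffs (P @ ys) = path_diffs P + mset_set {N + 1..N + 2 * int p}"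
    using path_diffs_append_Cons[of P ys] P ys by simp
  have "path_diffs (P @ ys) + cycles_diffs cs = (path_diffs P + cycles_diffs cs) + mset_set {N + 1..N + 2 * int p}"
    unfolding D by (simp add: ac_simps)
  also have "\<dots> = diffs_upto t (N + 2 * int p)" using P by (simp add: diffs_upto_join)
  finally have 1: "path_diffs (P @ ys) + cycles_diffs cs = diffs_upto t (N + 2 * int p)" .
  have "mset (P @ ys) + mset (concat cs) = mset ys + (mset P + mset (concat cs))" by (simp add: ac_simps)
  then have "mset (P @ ys) + mset (concat cs) = interval (a - s * int p) s (N + 2 * int p)"
    unfolding P(6) ys(2) .
  with 1 P ys have "end_labeling t (a - s * int p) s (N + 2 * int p) e cs (P @ ys)"
    unfolding end_labeling_def by simp
  with D show ?thesis by blast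
qed

lemma front_base_even: "front_base a s N (2 * k) = a - s * k" "front_dir s (2 * k) = s"
  by (simp_all add: front_base_def front_dir_def)

lemma front_base_odd: "front_base a s N (2 * k - 1) = a + s * N + s * k" "front_dir s (2 * k - 1) = - s"
  by (simp_all add: front_base_def front_dir_def)

text \<open>The even cycles are placed along the second path during its growth by the first
  \<open>N\<close> vertices, so that the interval has length \<open>3 * N + 1\<close> when the odd
  cycle begins. The bounds on \<open>evens_size ls\<close> and \<open>l\<close> provide the room for
  the cycles and the filling.\<close>

lemma odd_step:
  assumes st: "end_labeling t a s N e cs P" and N: "N = 2 * int p" "N \<ge> 2 * e + 4"
    and ls: "\<forall>l\<in>set ls. even l \<and> l \<ge> 4" "int (evens_size ls) + 6 \<le> N"
    and l: "odd l" "l \<ge> 3" "3 * int l + 7 \<le> 2 * (N + 2 * e + 7)"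
    and d: "d \<in> {0, 1}"
  shows "\<exists>a' s' cs' P'. end_labeling t a' s' (4 * N + 2 * e + 8 + d) (N + e + 2) (cs @ cs') P' \<and>
    map length cs' = ls @ [l]"
proof -
  have P: "P \<noteq> []" "last P = a + s * e" "\<bar>s\<bar> = 1" "3 \<le> N" "0 \<le> e"
    "mset P + mset (concat cs) = interval a s N" "path_diffs P + cycles_diffs cs = diffs_upto t N"
    using st by (simp_all add: end_labeling_def)
  define z where "z = a - s"
  define N2 where "N2 = 2 * N + 1"
  \<comment> \<open>The far side will receive \<open>F\<close> further vertices. The value makes the
    edge between the ends of the two paths have the free difference:
    \<open>N2 + F - \<epsilon> - (e + 1) = N2 + N + 3 - \<epsilon>\<close>.\<close>
  define F where "F = N + e + 4"
  define a2 where "a2 = z - s * int p"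
  have iz: "interval z s (N + 1) = add_mset z (interval a s N)"
    unfolding z_def using P by (intro interval_near) auto
  \<comment> \<open>Seen from \<open>z\<close>, the interval including \<open>z\<close> has length
    \<open>N + 1\<close> and the path ends at distance \<open>e + 1\<close>; thus the extension
    leaves the difference \<open>N + 1\<close> free.\<close>
  obtain ys0 where ys0: "ys0 \<noteq> []" "mset ys0 + interval z s (N + 1) = interval a2 s N2"
    "path_diffs ((z + s * (e + 1)) # ys0) = mset_set {N + 2..N2}" "last ys0 = a2 + s * (e + 1)"
    using path_extension[of s "N + 1" "e + 1" p z] P N unfolding a2_def N2_def by auto
  have "mset (P @ ys0) + mset (concat cs) + {#z#} = mset ys0 + add_mset z (mset P + mset (concat cs))"
    by simp
  then have V0: "mset (P @ ys0) + mset (concat cs) + {#z#} = interval a2 s N2"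
    unfolding P(6) iz[symmetric] ys0(2) .
  have lP: "last P = z + s * (e + 1)" using P by (simp add: z_def algebra_simps)
  have D0: "path_diffs (P @ ys0) + cycles_diffs cs + {#N + 1#} = diffs_upto t N2"
  proof -
    have "path_diffs (P @ ys0) + cycles_diffs cs + {#N + 1#} = (path_diffs P + cycles_diffs cs) + add_mset (N + 1) (mset_set {N + 2..N2})"
      using path_diffs_append_Cons[of P ys0] P(1) ys0(3) lP by (simp add: ac_simps)
    also have "add_mset (N + 1) (mset_set {N + 2..N2}) = mset_set {N + 1..N2}"
      using mset_interval_adj[of "N + 2" "N + 1" "N + 1" N2] P(4) by (simp add: N2_def)
    finally show ?thesis using P(4,7) by (simp add: diffs_upto_join N2_def)
  qed
  \<comment> \<open>The side on which the second path starts determines the parity of the final length.\<close>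
  define \<alpha> \<sigma> where "\<alpha> = (if d = 0 then a2 else a2 + s * N2)" and "\<sigma> = (if d = 0 then s else - s)"
  define T where "T = (if d = 0 then 2 * F - 1 else 2 * F)"
  define \<epsilon> :: int where "\<epsilon> = (if l = 3 then 0 else 1)"
  have \<sigma>: "\<bar>\<sigma>\<bar> = 1" using P by (simp add: \<sigma>_def)
  have N2: "N2 \<ge> 0" using P by (simp add: N2_def)
  have iv: "interval \<alpha> \<sigma> N2 = interval a2 s N2"
    unfolding \<alpha>_def \<sigma>_def using P(3) by (auto intro: interval_flip)
  obtain ys1 cs1 where g1: "growth {#} {#} {#} 1 \<alpha> \<sigma> N2 N ys1 cs1" and cs1: "map length cs1 = ls"
    using growth_evens_fill[OF \<sigma> N2 ls(1), of "2 * p" \<alpha>] ls(2) N by auto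
  have n: "2 * nat (T - N) \<ge> 3 * l + 7" "int (nat (T - N)) = T - N"
    using l P(4,5) by (auto simp: T_def F_def)
  have front: "front_base \<alpha> \<sigma> N2 N = \<alpha> - \<sigma> * int p" "front_dir \<sigma> N = \<sigma>"
    unfolding N(1) by (simp_all add: front_base_even)
  obtain ys2 c where g2: "growth {#z#} {#N2 + N + 3 - \<epsilon>#}
      {#\<bar>z - (\<alpha> - \<sigma> * int p - \<sigma>)\<bar>, \<bar>z - (\<alpha> - \<sigma> * int p + \<sigma> * (N2 + N + 1))\<bar>#} \<epsilon>
      (front_base \<alpha> \<sigma> N2 N) (front_dir \<sigma> N) (N2 + N) (T - N) ys2 [c]" and c: "length c = l"
    using growth_odd_fill[OF \<sigma> _ l(1,2) n(1), of "N2 + N" z "\<alpha> - \<sigma> * int p"] N2 P(4) n(2) front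
    unfolding \<epsilon>_def by auto
  have s: "s = 1 \<or> s = -1" using P(3) by linarith
  \<comment> \<open>The vertex \<open>z\<close> lies \<open>p\<close> inside the interval of length
    \<open>N2\<close>, and by now \<open>p\<close> vertices have been added on each side.\<close>
  have "{#\<bar>z - (\<alpha> - \<sigma> * int p - \<sigma>)\<bar>, \<bar>z - (\<alpha> - \<sigma> * int p + \<sigma> * (N2 + N + 1))\<bar>#} = {#N + 1, N2 + 1#}"
    using s N P(4) by (auto simp: \<alpha>_def \<sigma>_def a2_def N2_def algebra_simps)
  note g2 = g2[unfolded this]
  define Q where "Q = ys1 @ ys2"
  define M where "M = N2 + N + 3 - \<epsilon>"
  have g: "growth {#z#} {#M#} {#N + 1, N2 + 1#} \<epsilon> \<alpha> \<sigma> N2 T Q (cs1 @ [c])"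
    using growth_trans[OF g1 g2] P(4) n(2) unfolding Q_def M_def by simp
  have T: "T > 0" using P(4,5) by (auto simp: T_def F_def)
  then have Q: "Q \<noteq> []" "hd Q = \<alpha> + \<sigma> * (N2 + 2)"
    using g by (auto simp: growth_def split: if_splits)
  have sh: "front_dir \<sigma> T = - s" "front_base \<alpha> \<sigma> N2 T = a2 + s * (N2 + F)"
    by (cases "d = 0"; simp add: T_def \<alpha>_def \<sigma>_def front_base_even front_base_odd distrib_left)+
  have lQ: "last Q = a2 + s * (N2 + F - \<epsilon>)"
  proof -
    have "last Q = front_base \<alpha> \<sigma> N2 T + \<epsilon> * front_dir \<sigma> T" using g Q by (simp add: growth_def)
    also have "\<dots> = a2 + s * (N2 + F - \<epsilon>)"
      unfolding sh by (simp add: algebra_simps)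
    finally show ?thesis .
  qed
  \<comment> \<open>The growth counts an edge from \<open>\<alpha> + \<sigma>\<close> to the start
    of \<open>Q\<close> that the labeling does not contain. Its difference \<open>N2 + 1\<close> is
    the one used at \<open>z\<close>.\<close>
  have "\<bar>\<alpha> + \<sigma> - hd Q\<bar> = N2 + 1" unfolding Q using \<sigma> N2 by (auto simp: abs_if algebra_simps split: if_splits)
  then have "add_mset (N2 + 1) (path_diffs Q) + cycles_diffs (cs1 @ [c]) + {#M#} = mset_set {N2 + 1..N2 + T} + {#N + 1, N2 + 1#}"
    using g Q(1) by (simp add: growth_def path_diffs_Cons)
  then have DQ: "path_diffs Q + cycles_diffs (cs1 @ [c]) + {#M#} = mset_set {N2 + 1..N2 + T} + {#N + 1#}"
    by simp
  have VQ: "mset Q + mset (concat (cs1 @ [c])) + interval a2 s N2 = interval (front_base \<alpha> \<sigma> N2 T) (front_dir \<sigma> T) (N2 + T) + {#z#}"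
    using g iv by (simp add: growth_def)
  define P' where "P' = (P @ ys0) @ rev Q"
  define cs' where "cs' = cs1 @ [c]"
  have "\<bar>last (P @ ys0) - hd (rev Q)\<bar> = M"
    using s ys0 lQ Q(1) P(4,5) N2 unfolding M_def F_def \<epsilon>_def
    by (auto simp: hd_rev algebra_simps)
  then have "path_diffs P' = path_diffs (P @ ys0) + add_mset M (path_diffs Q)"
    unfolding P'_def using path_diffs_append[of "P @ ys0" "rev Q"] P(1) Q(1) by (simp add: path_diffs_rev)
  then have "path_diffs P' + cycles_diffs (cs @ cs') = path_diffs (P @ ys0) + cycles_diffs cs + (path_diffs Q + cycles_diffs (cs1 @ [c]) + {#M#})"
    by (simp add: cs'_def ac_simps)
  also have "\<dots> = (path_diffs (P @ ys0) + cycles_diffs cs + {#N + 1#}) + mset_set {N2 + 1..N2 + T}"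
    unfolding DQ by (simp add: ac_simps)
  also have "\<dots> = diffs_upto t (N2 + T)"
    unfolding D0 using P(4) T by (intro diffs_upto_join) (auto simp: N2_def)
  finally have D: "path_diffs P' + cycles_diffs (cs @ cs') = diffs_upto t (N2 + T)" .
  \<comment> \<open>The old interval is added on both sides because \<open>VQ\<close> contains it;
    it is cancelled together with \<open>z\<close> at the end.\<close>
  have "mset P' + mset (concat (cs @ cs')) + {#z#} + interval a2 s N2 =
      (mset (P @ ys0) + mset (concat cs) + {#z#}) + (mset Q + mset (concat (cs1 @ [c])) + interval a2 s N2)"
    by (simp add: P'_def cs'_def ac_simps)
  also have "\<dots> = interval (front_base \<alpha> \<sigma> N2 T) (front_dir \<sigma> T) (N2 + T) + {#z#} + interval a2 s N2"
    unfolding V0 VQ by (simp add: ac_simps)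
  finally have V: "mset P' + mset (concat (cs @ cs')) = interval (front_base \<alpha> \<sigma> N2 T) (front_dir \<sigma> T) (N2 + T)"
    by simp
  have NT: "N2 + T = 4 * N + 2 * e + 8 + d" using d by (auto simp: N2_def T_def F_def)
  have lP': "last P' = \<alpha> + \<sigma> * (N2 + 2)" unfolding P'_def using Q by (simp add: last_rev)
  \<comment> \<open>\<open>Q\<close> is traversed backwards, so the new path ends at its first
    vertex. This lies on the far side if \<open>d = 0\<close> and on the near side otherwise, at
    distance \<open>F - 2\<close> from the new end point there.\<close>
  obtain a' s' where a': "interval a' s' (N2 + T) = interval (front_base \<alpha> \<sigma> N2 T) (front_dir \<sigma> T) (N2 + T)" "\<bar>s'\<bar> = 1"
    "last P' = a' + s' * (F - 2)"
  proof (cases "d = 0")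
    case True
    have "last P' = front_base \<alpha> \<sigma> N2 T + front_dir \<sigma> T * (F - 2)"
      unfolding lP' sh using True by (simp add: \<alpha>_def \<sigma>_def algebra_simps)
    then show ?thesis using that \<sigma> by auto
  next
    case False
    let ?a = "front_base \<alpha> \<sigma> N2 T + front_dir \<sigma> T * (N2 + T)"
    have "last P' = ?a + (- front_dir \<sigma> T) * (F - 2)"
      unfolding lP' sh using False by (simp add: T_def \<alpha>_def \<sigma>_def algebra_simps)
    moreover have "interval ?a (- front_dir \<sigma> T) (N2 + T) = interval (front_base \<alpha> \<sigma> N2 T) (front_dir \<sigma> T) (N2 + T)"
      using \<sigma> by (intro interval_flip) auto
    ultimately show ?thesis using that \<sigma> by auto
  qed
  have "end_labeling t a' s' (N2 + T) (F - 2) (cs @ cs') P'"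
    unfolding end_labeling_def using a' D V P(1,4,5) T by (simp add: P'_def N2_def F_def)
  moreover have "F - 2 = N + e + 2" by (simp add: F_def)
  moreover have "map length cs' = ls @ [l]" using cs1 c by (simp add: cs'_def)
  ultimately show ?thesis unfolding NT by metis
qed

section \<open>Choosing the steps\<close>

lemma end_labeling_base_path: "end_labeling False 0 1 3 1 [] [3, 0, 2, 1]"
proof -
  have "{0..3::int} = {0,1,2,3}" "{1..3::int} = {1,2,3}" by auto
  then show ?thesis by (simp add: end_labeling_def interval_def diffs_upto_def)
qed

lemma end_labeling_base_two: "end_labeling True 0 1 3 1 [[0, 3]] [2, 1]"
proof -
  have "{0..3::int} = {0,1,2,3}" by auto
  then show ?thesis by (simp add: end_labeling_def interval_def diffs_upto_def cycle_diffs_def)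
qed

text \<open>The smallest open odd cycle has the vertices \<open>0, 2, 3\<close>, next to the path consisting of
  \<open>1\<close> alone. The surplus multisets \<open>{1, 2, 3}\<close> and \<open>{1, 1, 2}\<close> in the proof present it
  formally as an open growth of the interval from 3 to 1, although nothing has been labeled there.\<close>

lemma end_labeling_base_odd:
  assumes "odd l" "l \<ge> 3"
  shows "\<exists>a s N c P. end_labeling False a s N 1 [c] P \<and> length c = l \<and> 2 * N = 3 * int l - 3"
proof -
  define k where "k = (l - 3) div 2"
  have l: "l = 3 + 2 * k"
    using assms unfolding k_def by (auto elim!: oddE)
  have i: "{0..3::int} = {0,1,2,3}" "{1..3::int} = {1,2,3}" by auto
  have "open_growth {#1, 2, 3#} {#} {#1, 1, 2#} 1 3 (-1) 2 1 [1] [0, 2, 3]"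
    using i by (simp add: open_growth_def front_base_def front_dir_def interval_def)
  from open_growth_steps[OF _ _ _ this, of k] obtain ys fr where
    t: "open_growth {#1, 2, 3#} {#} {#1, 1, 2#} 1 3 (-1) 2 (1 + 3 * int k) ys fr" "length fr = l"
    using l by auto
  let ?T = "1 + 3 * int k"
  let ?a = "front_base 3 (-1) 2 ?T" and ?s = "front_dir (-1) ?T"
  have y: "ys \<noteq> []" "hd ys = 1" using t(1) by (simp_all add: open_growth_def)
  have "interval 3 (-1) 2 = {#1, 2, 3#}" using i by (simp add: interval_def)
  then have V: "mset ys + mset (concat [fr]) = interval ?a ?s (2 + ?T)"
    using t(1) unfolding open_growth_def by auto
  have "path_diffs (2 # ys) + cycle_diffs fr = mset_set {3..2 + ?T} + {#1, 1, 2#}"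
    using open_growth_close_diff[OF _ _ _ t(1)] by simp
  \<comment> \<open>Dropping the fictitious edge from 2 to 1 removes one of the two surplus
    differences 1.\<close>
  then have "path_diffs ys + cycle_diffs fr = mset_set {3..2 + ?T} + {#1, 2#}"
    using y by (simp add: path_diffs_Cons)
  also have "{#1, 2#} = mset_set {1..2::int}"
    using mset_interval_small(1)[of 0] by simp
  finally have "path_diffs ys + cycles_diffs [fr] = mset_set {1..2 + ?T}"
    using mset_interval_adj[of 3 2 1 "2 + ?T"] by (simp add: add.commute)
  moreover have "last ys = ?a + ?s * 1"
    using t(1) unfolding open_growth_def by auto
  ultimately have "end_labeling False ?a ?s (2 + ?T) 1 [fr] ys"
    using V y unfolding end_labeling_def diffs_upto_def by simp
  moreover have "2 * (2 + ?T) = 3 * int l - 3" using l by simp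
  ultimately show ?thesis using t(2) by blast
qed

lemma end_labeling_fill:
  assumes "end_labeling t a s N 1 cs P" "n \<ge> 6"
  shows "\<exists>a' s' P'. end_labeling t a' s' (N + int n) 1 cs P' \<and> path_diffs P' = path_diffs P + mset_set {N + 1..N + int n}"
proof -
  have "\<bar>s\<bar> = 1" "N \<ge> 0" using assms by (simp_all add: end_labeling_def)
  then obtain ys where g: "growth {#} {#} {#} 1 a s N (int n) ys []"
    using growth_fill fillable_ge assms(2) by blast
  from end_labeling_grow[OF assms(1) g] show ?thesis by (auto intro!: exI)
qed

lemma end_labeling_evens:
  assumes "end_labeling t a s N 1 cs P" "\<forall>l\<in>set ls. even l \<and> l \<ge> 4"
  shows "\<exists>a' s' P' cs'. end_labeling t a' s' (N + int (evens_size ls)) 1 (cs @ cs') P' \<and> map length cs' = ls"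
proof -
  have "\<bar>s\<bar> = 1" "N \<ge> 0" using assms by (simp_all add: end_labeling_def)
  then obtain ys cs' where g: "growth {#} {#} {#} 1 a s N (int (evens_size ls)) ys cs'" "map length cs' = ls"
    using growth_evens assms(2) by blast
  from end_labeling_grow(1)[OF assms(1) g(1)] g(2) show ?thesis by auto
qed

text \<open>Taking \<open>d = 0\<close> and no even cycles keeps the length even. The inequality
  \<open>2 * e + 4 \<le> N\<close> is inherited by the new values and bounds the new length
  \<open>4 * N + 2 * e + 8\<close> by \<open>7 * N\<close>.\<close>

lemma odd_steps:
  assumes "end_labeling t a s N e cs P" "even N" "2 * e + 4 \<le> N" "2 * int M + 4 \<le> N" "M \<ge> 3"
    and "\<forall>l\<in>set rs. odd l \<and> 3 \<le> l \<and> l \<le> M"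
  shows "\<exists>a' s' N' e' cs' P'. end_labeling t a' s' N' e' (cs @ cs') P' \<and> map length cs' = rs \<and> even N' \<and>
    2 * e' + 4 \<le> N' \<and> N \<le> N' \<and> N' \<le> 7 ^ length rs * N"
  using assms(6)
proof (induction rs rule: rev_induct)
  case Nil
  have "end_labeling t a s N e (cs @ []) P" using assms by simp
  then show ?case using assms by (intro exI[of _ a] exI[of _ s] exI[of _ N] exI[of _ e] exI[of _ "[]"] exI[of _ P]) simp
next
  case (snoc l rs)
  then obtain a' s' N' e' cs' P' where IH: "end_labeling t a' s' N' e' (cs @ cs') P'" "map length cs' = rs"
    "even N'" "2 * e' + 4 \<le> N'" "N \<le> N'" "N' \<le> 7 ^ length rs * N" by auto
  have p: "N' = 2 * int (nat (N' div 2))" using IH assms by auto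
  have "3 * int l + 7 \<le> 2 * (N' + 2 * e' + 7)"
    using snoc.prems IH assms by (auto simp: end_labeling_def)
  moreover have "int (evens_size []) + 6 \<le> N'" using IH assms by (simp add: evens_size_def)
  ultimately obtain a'' s'' cs'' P'' where *: "end_labeling t a'' s'' (4 * N' + 2 * e' + 8 + 0) (N' + e' + 2) ((cs @ cs') @ cs'') P''"
    "map length cs'' = [] @ [l]"
    using odd_step[OF IH(1) p IH(4), of "[]" l 0] snoc.prems by auto
  have "e' \<ge> 0" using IH by (simp add: end_labeling_def)
  have "4 * N' + 2 * e' + 8 \<le> 7 * N'" using IH(4,5) assms by linarith
  also have "\<dots> \<le> 7 ^ length (rs @ [l]) * N" using IH(6) by simp
  finally have b: "4 * N' + 2 * e' + 8 \<le> 7 ^ length (rs @ [l]) * N" .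
  have "end_labeling t a'' s'' (4 * N' + 2 * e' + 8) (N' + e' + 2) (cs @ (cs' @ cs'')) P''"
    using * by simp
  moreover have "map length (cs' @ cs'') = rs @ [l]" using IH(2) *(2) by simp
  moreover have "even (4 * N' + 2 * e' + 8)" by simp
  moreover have "2 * (N' + e' + 2) + 4 \<le> 4 * N' + 2 * e' + 8" "N \<le> 4 * N' + 2 * e' + 8"
    using IH(4,5) \<open>e' \<ge> 0\<close> by auto
  ultimately show ?case using b by blast
qed

lemma evens_size_bound: "\<forall>l\<in>set ls. l \<le> m \<Longrightarrow> 2 * evens_size ls \<le> 3 * (length ls * m)"
proof (induction ls)
  case (Cons l ls)
  have "l \<le> m" using Cons.prems by simp
  then have "2 * (3 * (l div 2) - 1) \<le> 3 * m" by linarith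
  then show ?case using Cons by (simp add: evens_size_def algebra_simps)
qed (simp add: evens_size_def)

lemma max_mset_ge: "l \<in># L \<Longrightarrow> l \<le> max_mset L"
  by (auto simp: max_mset_def)

lemma evens_size_eps0:
  assumes "mset ls = L0"
  shows "evens_size ls \<le> eps0 L0"
proof (cases "L0 = {#}")
  case True
  then show ?thesis using assms by (simp add: evens_size_def)
next
  case False
  have "2 * evens_size ls \<le> 3 * (size L0 * max_mset L0)"
    using evens_size_bound[of ls "max_mset L0"] max_mset_ge[of _ L0] assms by (auto simp flip: size_mset set_mset_mset)
  moreover have "size L0 \<ge> 1" using False by (cases "size L0") auto
  moreover have "2 * size L0 * (max_mset L0 + 3) = 2 * (size L0 * max_mset L0) + 6 * size L0"
    by (simp add: algebra_simps)
  ultimately show ?thesis unfolding eps0_def by linarith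
qed

text \<open>If an odd step is needed, the even cycles are placed within the last one, so that their
  size is not multiplied by powers of 7. With at most one odd cycle or 2-cycle no odd step is
  needed, and the even cycles are grown directly around the centre.\<close>

lemma end_labeling_exists:
  fixes L0 L1 :: "nat multiset" and a \<epsilon> :: nat
  assumes L0: "\<And>l. l \<in># L0 \<Longrightarrow> l mod 2 = 0 \<and> l > 2"
    and L1: "\<And>l. l \<in># L1 \<Longrightarrow> l mod 2 = 1 \<and> l > 2"
    and a: "a \<in> {0, 1}"
    and \<epsilon>: "\<epsilon> \<ge> 6 * eps0 L0 + 7 * eps1 L1 a + 9"
  shows "\<exists>x s e cs P. end_labeling (a = 1) x s (int \<epsilon>) e cs P \<and> mset (map length cs) = L0 + L1 + replicate_mset a 2 \<and>
     mset_set {int (4 * eps0 L0 + 5 * eps1 L1 a + 7)..int \<epsilon>} \<subseteq># path_diffs P"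
proof -
  obtain ls where ls: "mset ls = L0" using ex_mset by blast
  obtain rs where rs: "mset rs = L1" using ex_mset by blast
  have lse: "\<forall>l\<in>set ls. even l \<and> l \<ge> 4"
  proof
    fix l assume "l \<in> set ls"
    then have "l mod 2 = 0" "l > 2" using L0[of l] ls by (auto simp flip: set_mset_mset)
    then show "even l \<and> l \<ge> 4" by presburger
  qed
  have rso: "odd l \<and> 3 \<le> l \<and> l \<le> max_mset L1" if "l \<in> set rs" for l
  proof -
    have "l \<in># L1" using that rs by auto
    then show ?thesis using L1[of l] max_mset_ge[of l L1] by (auto simp: odd_iff_mod_2_eq_one)
  qed
  define M where "M = max_mset L1"
  have sz: "evens_size ls \<le> eps0 L0" by (rule evens_size_eps0[OF ls])
  have sub: "mset_set {K..n} \<subseteq># A + mset_set {m..n}" if "m \<le> K" for K m n :: int and A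
  proof -
    have "mset_set {K..n} \<subseteq># mset_set {m..n}" using that by (subst subset_imp_msubset_mset_set) auto
    also have "\<dots> \<subseteq># A + mset_set {m..n}" by simp
    finally show ?thesis .
  qed
  have base: "\<exists>x s N cs P. end_labeling (a = 1) x s N 1 cs P \<and>
      mset (map length cs) = (if a = 1 then {#2#} else if rs = [] then {#} else {#hd rs#}) \<and>
      2 * N \<le> (if a = 0 \<and> rs \<noteq> [] then 3 * int (hd rs) - 3 else 6)"
  proof (cases "a = 1")
    case True
    then show ?thesis using end_labeling_base_two by (intro exI[of _ 0] exI[of _ 1] exI[of _ 3] exI[of _ "[[0, 3]]"] exI) auto
  next
    case a0: False
    show ?thesis
    proof (cases "rs = []")
      case True
      then show ?thesis using a0 end_labeling_base_path by (intro exI[of _ 0] exI[of _ 1] exI[of _ 3] exI[of _ "[]"] exI) auto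
    next
      case False
      then have "odd (hd rs)" "3 \<le> hd rs" using rso[of "hd rs"] by auto
      from end_labeling_base_odd[OF this] obtain x s N c P where
        "end_labeling False x s N 1 [c] P" "length c = hd rs" "2 * N = 3 * int (hd rs) - 3" by blast
      then show ?thesis using a0 a False by (intro exI[of _ x] exI[of _ s] exI[of _ N] exI[of _ "[c]"] exI[of _ P]) auto
    qed
  qed
  then obtain x s N cs P where b: "end_labeling (a = 1) x s N 1 cs P"
    "mset (map length cs) = (if a = 1 then {#2#} else if rs = [] then {#} else {#hd rs#})"
    "2 * N \<le> (if a = 0 \<and> rs \<noteq> [] then 3 * int (hd rs) - 3 else 6)" by blast
  show ?thesis
  proof (cases "length rs + a \<le> 1")
    case True
    obtain x1 s1 P1 cs1 where e: "end_labeling (a = 1) x1 s1 (N + int (evens_size ls)) 1 (cs @ cs1) P1" "map length cs1 = ls"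
      using end_labeling_evens[OF b(1) lse] by blast
    have "2 * N \<le> 3 * int (eps1 L1 a)"
    proof (cases "a = 0 \<and> rs \<noteq> []")
      case True
      then have "hd rs \<le> max_mset L1" using rso[of "hd rs"] by simp
      moreover have "1 * (2 * max_mset L1 + 1) \<le> 7 ^ (size L1 + a - 1) * (2 * max_mset L1 + 1)"
        by (rule mult_le_mono1) simp
      then have "2 * max_mset L1 + 1 \<le> eps1 L1 a"
        unfolding eps1_def le_max_iff_disj by (simp only: mult_1 simp_thms)
      moreover have "2 * N \<le> 3 * int (hd rs) - 3" using b(3) True by simp
      ultimately show ?thesis by linarith
    next
      case False
      then have "2 * N \<le> 6" using b(3) by (simp split: if_splits)
      moreover have "eps1 L1 a \<ge> 3" by (simp add: eps1_def)
      ultimately show ?thesis by linarith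
    qed
    moreover have "eps1 L1 a \<ge> 3" by (simp add: eps1_def)
    ultimately have n: "N + int (evens_size ls) + 6 \<le> int \<epsilon>" "N + int (evens_size ls) + 1 \<le> int (4 * eps0 L0 + 5 * eps1 L1 a + 7)"
      using \<epsilon> sz by linarith+
    define n where "n = nat (int \<epsilon> - (N + int (evens_size ls)))"
    have "6 \<le> n" "N + int (evens_size ls) + int n = int \<epsilon>" using n by (auto simp: n_def)
    with end_labeling_fill[OF e(1), of n] obtain x2 s2 P2 where
      f: "end_labeling (a = 1) x2 s2 (int \<epsilon>) 1 (cs @ cs1) P2" "path_diffs P2 = path_diffs P1 + mset_set {N + int (evens_size ls) + 1..int \<epsilon>}"
      by auto
    have "rs = [] \<or> a = 0 \<and> rs = [hd rs]" using True by (cases rs) auto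
    then have "mset (map length (cs @ cs1)) = L0 + L1 + replicate_mset a 2"
      using b(2) e(2) ls rs a by (auto simp: add.commute)
    moreover have "mset_set {int (4 * eps0 L0 + 5 * eps1 L1 a + 7)..int \<epsilon>} \<subseteq># path_diffs P2"
      unfolding f(2) using n by (intro sub) auto
    ultimately show ?thesis using f(1) by blast
  next
    case False
    have rs0: "rs \<noteq> []" using False a by auto
    then have M3: "M \<ge> 3" and hdM: "hd rs \<le> M" using rso[of "hd rs"] by (auto simp: M_def)
    \<comment> \<open>The length \<open>2 * M + 4\<close> is what \<open>odd_steps\<close> requires
      for all odd lengths up to \<open>M\<close>.\<close>
    define n where "n = nat (2 * int M + 4 - N)"
    have n: "n \<ge> 6" "N + int n = 2 * int M + 4"
      using b(3) M3 hdM by (auto simp: n_def split: if_splits)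
    from end_labeling_fill[OF b(1) n(1)] n(2) obtain x1 s1 P1 where
      1: "end_labeling (a = 1) x1 s1 (2 * int M + 4) 1 cs P1" by auto
    \<comment> \<open>The last odd length is kept for the final odd step; if there is no 2-cycle,
      the first one is already in the centre.\<close>
    define rs' where "rs' = (if a = 1 then butlast rs else butlast (tl rs))"
    have rs': "mset rs' + {#last rs#} + mset (map length cs) = L1 + replicate_mset a 2"
      "length rs' + 2 = length rs + a" "set rs' \<subseteq> set rs"
    proof -
      have *: "mset rs = add_mset (last rs) (mset (butlast rs))" using rs0
        by (metis append_butlast_last_id mset.simps(2) mset_append mset.simps(1) union_mset_add_mset_right add.right_neutral)
      show "mset rs' + {#last rs#} + mset (map length cs) = L1 + replicate_mset a 2"
      proof (cases "a = 1")
        case True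
        then show ?thesis using * b(2) rs by (simp add: rs'_def)
      next
        case a1: False
        with a have a0: "a = 0" by auto
        then obtain r q qs where q: "rs = r # q # qs" using False by (cases rs; cases "tl rs") auto
        have "mset (butlast (q # qs)) + {#last (q # qs)#} = mset (q # qs)"
          by (metis append_butlast_last_id list.distinct(1) mset.simps mset_append)
        then show ?thesis using q b(2) rs a0 by (simp add: rs'_def)
      qed
      show "length rs' + 2 = length rs + a" using False a rs0 by (cases rs) (auto simp: rs'_def)
      show "set rs' \<subseteq> set rs" unfolding rs'_def by (auto dest: in_set_butlastD list.set_sel(2)[OF rs0])
    qed
    have "\<forall>l\<in>set rs'. odd l \<and> 3 \<le> l \<and> l \<le> M" using rso rs'(3) by (auto simp: M_def)
    from odd_steps[OF 1 _ _ _ M3 this] M3 obtain x2 s2 N2 e2 cs2 P2 where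
      2: "end_labeling (a = 1) x2 s2 N2 e2 (cs @ cs2) P2" "map length cs2 = rs'" "even N2" "2 * e2 + 4 \<le> N2"
      "2 * int M + 4 \<le> N2" "N2 \<le> 7 ^ length rs' * (2 * int M + 4)"
      by auto
    have e2: "e2 \<ge> 0" using 2 by (simp add: end_labeling_def)
    \<comment> \<open>The first two summands exceed \<open>e2\<close>, as
      \<open>end_labeling_extend\<close> requires; the others make room for the even cycles.\<close>
    define q where "q = nat e2 + 1 + evens_size ls div 2 + 4"
    define N3 where "N3 = N2 + 2 * int q"
    obtain P3 where 3: "end_labeling (a = 1) (x2 - s2 * int q) s2 N3 e2 (cs @ cs2) P3"
      using end_labeling_extend[OF 2(1), of q] e2 by (auto simp: q_def N3_def)
    have N3: "N3 = 2 * int (nat (N3 div 2))" "2 * e2 + 4 \<le> N3" "int (evens_size ls) + 6 \<le> N3"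
      "N3 \<le> N2 + 2 * e2 + 10 + int (evens_size ls)" "N2 \<le> N3"
      using 2 e2 by (auto simp: N3_def q_def)
    have lr: "odd (last rs)" "3 \<le> last rs" "last rs \<le> M" using rso[of "last rs"] rs0 by (auto simp: M_def)
    \<comment> \<open>The final extension adds an even number of vertices, so the parity of
      \<open>\<epsilon>\<close> has to be fixed here.\<close>
    define d where "d = int \<epsilon> mod 2"
    have d: "d \<in> {0, 1}" by (auto simp: d_def)
    have "3 * int (last rs) + 7 \<le> 2 * (N3 + 2 * e2 + 7)" 
    proof -
      have "int (last rs) \<le> int M" using lr(3) by simp
      then have "3 * int (last rs) \<le> 4 * int M" by simp
      moreover have "4 * int M + 8 \<le> 2 * N3" using 2(5) N3(5) by simp
      ultimately show ?thesis using e2 by simp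
    qed
    from odd_step[OF 3 N3(1,2) lse N3(3) lr(1,2) this d] obtain x4 s4 cs4 P4 where
      4: "end_labeling (a = 1) x4 s4 (4 * N3 + 2 * e2 + 8 + d) (N3 + e2 + 2) ((cs @ cs2) @ cs4) P4" "map length cs4 = ls @ [last rs]"
      by blast
    let ?N = "4 * N3 + 2 * e2 + 8 + d"
    define X :: nat where "X = 7 ^ length rs'"
    have X: "X \<ge> 1" by (simp add: X_def)
    have eps1: "7 * (X * (2 * M + 1)) \<le> eps1 L1 a"
    proof -
      have "size L1 = length rs" using rs by auto
      then have "size L1 + a - 1 = Suc (length rs')" using rs'(2) by simp
      then show ?thesis by (simp add: eps1_def X_def M_def le_max_iff_disj)
    qed
    have MX: "X * M \<ge> 3 * X" "X * M \<ge> 3" using M3 X by (auto intro: order.trans[OF _ mult_le_mono[of 1 X 3 M]])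
    have N2X: "N2 \<le> 2 * int (X * M) + 4 * int X" using 2(6) by (simp add: X_def algebra_simps)
    have epsX: "14 * (X * M) + 7 * X \<le> eps1 L1 a" using eps1 by (simp add: algebra_simps)
    have d1: "d \<le> 1" using d by auto
    have bnd: "?N + 2 * (N3 + e2 + 2) + 2 \<le> int \<epsilon>" "?N + 1 \<le> int (4 * eps0 L0 + 5 * eps1 L1 a + 7)"
    proof -
      \<comment> \<open>The products are named to make the problem linear. From
        \<open>N3 \<le> 2 * N2 + 6 + w\<close> and \<open>2 * e2 \<le> N2 - 4\<close>, the terms
        \<open>6 * N3\<close> and \<open>4 * N3\<close> give the coefficients 6 and 4 of
        \<open>eps0\<close>.\<close>
      define x y e0 e1 w where "x = int X * int M" and "y = int X" and "e0 = int (eps0 L0)"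
        and "e1 = int (eps1 L1 a)" and "w = int (evens_size ls)"
      have "3 * y \<le> x" "3 \<le> x"
        using MX(1,2)[folded of_nat_le_iff[where 'a = int]] by (simp_all add: x_def y_def)
      moreover have "14 * x + 7 * y \<le> e1"
        using epsX[folded of_nat_le_iff[where 'a = int]] by (simp add: x_def y_def e1_def)
      moreover have "w \<le> e0" using sz by (simp add: w_def e0_def)
      moreover have "6 * e0 + 7 * e1 + 9 \<le> int \<epsilon>"
        using \<epsilon>[folded of_nat_le_iff[where 'a = int]] by (simp add: e0_def e1_def)
      moreover have "N2 \<le> 2 * x + 4 * y" using N2X by (simp add: x_def y_def)
      moreover have "N3 \<le> N2 + 2 * e2 + 10 + w" using N3(4) by (simp add: w_def)
      moreover have "0 \<le> e0" "0 \<le> w" by (simp_all add: e0_def w_def)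
      ultimately have "6 * N3 + 4 * e2 + 14 + d \<le> int \<epsilon>" "4 * N3 + 2 * e2 + 9 + d \<le> 4 * e0 + 5 * e1 + 7"
        using 2(4) d1 by linarith+
      then show "?N + 2 * (N3 + e2 + 2) + 2 \<le> int \<epsilon>" "?N + 1 \<le> int (4 * eps0 L0 + 5 * eps1 L1 a + 7)"
        by (simp_all add: e0_def e1_def)
    qed
    have "even (int \<epsilon> - ?N)" by (simp add: d_def)
    then obtain h where h: "int \<epsilon> - ?N = 2 * h" by (elim evenE)
    define p where "p = nat h"
    have p: "N3 + e2 + 2 < int p" "?N + 2 * int p = int \<epsilon>"
      using h bnd e2 N3(5) 2(4) by (auto simp: p_def)
    from end_labeling_extend[OF 4(1) p(1)] obtain P5 where
      5: "end_labeling (a = 1) (x4 - s4 * int p) s4 (int \<epsilon>) (N3 + e2 + 2) ((cs @ cs2) @ cs4) P5"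
      "path_diffs P5 = path_diffs P4 + mset_set {?N + 1..int \<epsilon>}" unfolding p(2) by blast
    have "mset (map length ((cs @ cs2) @ cs4)) = L0 + (mset rs' + {#last rs#} + mset (map length cs))"
      using 2(2) 4(2) ls by (simp add: ac_simps)
    then have "mset (map length ((cs @ cs2) @ cs4)) = L0 + L1 + replicate_mset a 2"
      unfolding rs'(1) by (simp add: ac_simps)
    moreover have "mset_set {int (4 * eps0 L0 + 5 * eps1 L1 a + 7)..int \<epsilon>} \<subseteq># path_diffs P5"
      unfolding 5(2) using bnd by (intro sub) auto
    ultimately show ?thesis using 5(1) by blast
  qed
qed

section \<open>From lists of labels to graphs\<close>

definition edge_diff :: "int set \<Rightarrow> int multiset" where
  "edge_diff e = {#u - w. (u, w) \<in># mset_set {(u, w). u \<in> e \<and> w \<in> e \<and> u \<noteq> w}#}"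

definition edge_diffs :: "int set multiset \<Rightarrow> int multiset" where
  "edge_diffs E = (\<Sum>e\<in>#E. edge_diff e)"

lemma edge_diff_pair:
  assumes "x \<noteq> y"
  shows "edge_diff {x, y} = plus_minus {#\<bar>x - y\<bar>#}"
proof -
  have "{(u, w). u \<in> {x, y} \<and> w \<in> {x, y} \<and> u \<noteq> w} = {(x, y), (y, x)}" using assms by auto
  then show ?thesis using assms by (auto simp: edge_diff_def plus_minus_def abs_if)
qed

lemma differences_edge_diffs: "differences G = edge_diffs (edges G)"
  by (simp add: differences_def edge_diffs_def edge_diff_def)

lemma edge_diffs_simps [simp]:
  "edge_diffs {#} = {#}" "edge_diffs (add_mset e E) = edge_diff e + edge_diffs E"
  "edge_diffs (E + E') = edge_diffs E + edge_diffs E'"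
  by (simp_all add: edge_diffs_def)

lemma edge_diffs_sum: "finite I \<Longrightarrow> edge_diffs (\<Sum>i\<in>I. E i) = (\<Sum>i\<in>I. edge_diffs (E i))"
  by (induction I rule: finite_induct) auto

lemma plus_minus_add: "plus_minus (A + B) = plus_minus A + plus_minus B"
  by (simp add: plus_minus_def)

lemma plus_minus_simps [simp]: "plus_minus {#} = {#}"
  by (simp add: plus_minus_def)

lemma plus_minus_sum_list: "plus_minus (\<Sum>x\<leftarrow>xs. A x) = (\<Sum>x\<leftarrow>xs. plus_minus (A x))"
  by (induction xs) (auto simp: plus_minus_add)

lemma path_diffs_conv_nth: "path_diffs xs = {#\<bar>xs ! i - xs ! Suc i\<bar>. i \<in># mset_set {..<length xs - 1}#}"
proof (induction xs rule: rev_induct)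
  case (snoc x xs)
  show ?case
  proof (cases "xs = []")
    case False
    then obtain n where n: "length xs = Suc n" by (cases xs) auto
    have "path_diffs (xs @ [x]) = path_diffs xs + {#\<bar>last xs - x\<bar>#}" using False by (simp add: path_diffs_append)
    also have "path_diffs xs = {#\<bar>xs ! i - xs ! Suc i\<bar>. i \<in># mset_set {..<n}#}"
      using snoc.IH n by simp
    also have "\<dots> = {#\<bar>(xs @ [x]) ! i - (xs @ [x]) ! Suc i\<bar>. i \<in># mset_set {..<n}#}"
      using n by (intro image_mset_cong) (auto simp: nth_append)
    also have "last xs = (xs @ [x]) ! n" using n False by (simp add: last_conv_nth nth_append)
    finally show ?thesis using n by (simp add: lessThan_Suc nth_append)
  qed simp
qed simp

lemma path_edge_diffs:
  assumes "distinct xs" "length xs = Suc m"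
  shows "edge_diffs {#{xs ! i, xs ! Suc i}. i \<in># mset_set {..<m}#} = plus_minus (path_diffs xs)"
proof -
  have "edge_diffs {#{xs ! i, xs ! Suc i}. i \<in># mset_set {..<k}#} =
      plus_minus {#\<bar>xs ! i - xs ! Suc i\<bar>. i \<in># mset_set {..<k}#}" if "k \<le> m" for k
    using that
  proof (induction k)
    case (Suc k)
    have "xs ! k \<noteq> xs ! Suc k" using assms Suc.prems by (simp add: nth_eq_iff_index_eq)
    then have "edge_diff {xs ! k, xs ! Suc k} = plus_minus {#\<bar>xs ! k - xs ! Suc k\<bar>#}"
      by (rule edge_diff_pair)
    then show ?case using Suc by (simp add: lessThan_Suc plus_minus_def)
  qed simp
  from this[of m] show ?thesis using assms by (simp add: path_diffs_conv_nth)
qed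

lemma cycle_edge_diffs:
  assumes "distinct xs" "length xs = l" "l \<ge> 2"
  shows "edge_diffs {#{xs ! i, xs ! (Suc i mod l)}. i \<in># mset_set {..<l}#} = plus_minus (cycle_diffs xs)"
proof -
  obtain m where m: "l = Suc m" "m \<ge> 1" using assms(3) by (cases l) auto
  \<comment> \<open>Only the last index wraps around; for \<open>l = 2\<close> this edge is parallel
    to the first one.\<close>
  have "{#{xs ! i, xs ! (Suc i mod l)}. i \<in># mset_set {..<l}#} =
      {#{xs ! i, xs ! Suc i}. i \<in># mset_set {..<m}#} + {#{xs ! m, xs ! 0}#}"
    unfolding m(1) by (simp add: lessThan_Suc) (intro image_mset_cong, auto)
  moreover have "xs ! m \<noteq> xs ! 0" using assms m by (simp add: nth_eq_iff_index_eq)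
  moreover have "xs \<noteq> []" using assms by auto
  then have "last xs = xs ! m" "hd xs = xs ! 0" using assms m
    by (simp_all add: last_conv_nth hd_conv_nth)
  ultimately show ?thesis
    using path_edge_diffs[of xs m] edge_diff_pair[of "xs ! m" "xs ! 0"] assms m
    by (simp add: cycle_diffs_def plus_minus_def ac_simps)
qed

section \<open>The vertex map given by lists of labels\<close>

fun component_label :: "int list list \<Rightarrow> int list \<Rightarrow> component \<times> nat \<Rightarrow> int" where
  "component_label cs P (Path, i) = P ! i"
| "component_label cs P (Cycle l j, i) = filter (\<lambda>c. length c = l) cs ! j ! i"

definition component_list :: "int list list \<Rightarrow> int list \<Rightarrow> component \<Rightarrow> int list" where
  "component_list cs P k = (case k of Path \<Rightarrow> P | Cycle l j \<Rightarrow> filter (\<lambda>c. length c = l) cs ! j)"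

lemma component_label_nth: "component_label cs P (k, i) = component_list cs P k ! i"
  by (cases k) (auto simp: component_list_def)

lemma count_length_filter: "count (mset (map length cs)) l = length (filter (\<lambda>c. length c = l) cs)"
  by (induction cs) auto

lemma filter_sum_lengths:
  fixes g :: "int list \<Rightarrow> 'a::comm_monoid_add"
  shows "(\<Sum>c\<leftarrow>cs. g c) = (\<Sum>l\<in>set (map length cs). \<Sum>j<length (filter (\<lambda>c. length c = l) cs). g (filter (\<lambda>c. length c = l) cs ! j))"
proof -
  \<comment> \<open>The index set is fixed in advance so that it does not change during the
    induction on \<open>cs\<close>.\<close>
  have "(\<Sum>c\<leftarrow>cs. g c) = (\<Sum>l\<in>S. \<Sum>c\<leftarrow>filter (\<lambda>c. length c = l) cs. g c)"
    if "finite S" "set (map length cs) \<subseteq> S" for S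
    using that(2)
  proof (induction cs)
    case (Cons c cs)
    have "(\<Sum>l\<in>S. \<Sum>c\<leftarrow>filter (\<lambda>x. length x = l) (c # cs). g c) =
        (\<Sum>l\<in>S. (if l = length c then g c else 0) + (\<Sum>c\<leftarrow>filter (\<lambda>x. length x = l) cs. g c))"
      by (intro sum.cong) auto
    also have "\<dots> = g c + (\<Sum>l\<in>S. \<Sum>c\<leftarrow>filter (\<lambda>x. length x = l) cs. g c)"
      using that(1) Cons.prems by (simp add: sum.distrib)
    finally show ?case using Cons by simp
  qed simp
  from this[of "set (map length cs)"] show ?thesis
    by (simp add: sum_list_sum_nth atLeast0LessThan)
qed

definition cycle_components :: "int list list \<Rightarrow> component set" where
  "cycle_components cs = {Cycle l j |l j. j < length (filter (\<lambda>c. length c = l) cs)}"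

lemma sum_components:
  fixes g :: "int list \<Rightarrow> 'a::comm_monoid_add"
  shows "finite (cycle_components cs)" "(\<Sum>k\<in>cycle_components cs. g (component_list cs P k)) = (\<Sum>c\<leftarrow>cs. g c)"
proof -
  let ?f = "\<lambda>l. filter (\<lambda>c. length c = l) cs"
  have C: "cycle_components cs = (\<lambda>(l, j). Cycle l j) ` (SIGMA l:set (map length cs). {..<length (?f l)})"
  proof -
    have "l \<in> set (map length cs)" if "j < length (?f l)" for l j
    proof -
      have "?f l ! j \<in> set (?f l)" using that by (rule nth_mem)
      then show ?thesis by (auto intro!: rev_image_eqI)
    qed
    then show ?thesis unfolding cycle_components_def by (auto simp: image_def)
  qed
  show "finite (cycle_components cs)" unfolding C by auto
  have "(\<Sum>k\<in>cycle_components cs. g (component_list cs P k)) =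
      (\<Sum>(l, j)\<in>(SIGMA l:set (map length cs). {..<length (?f l)}). g (?f l ! j))"
    unfolding C by (subst sum.reindex) (auto simp: inj_on_def component_list_def intro!: sum.cong)
  also have "\<dots> = (\<Sum>c\<leftarrow>cs. g c)"
    unfolding filter_sum_lengths[of g cs] by (subst sum.Sigma[symmetric]) auto
  finally show "(\<Sum>k\<in>cycle_components cs. g (component_list cs P k)) = (\<Sum>c\<leftarrow>cs. g c)" .
qed

lemma image_mset_sum:
  "finite I \<Longrightarrow> image_mset f (\<Sum>i\<in>I. M i) = (\<Sum>i\<in>I. image_mset f (M i))"
  by (induction I rule: finite_induct) auto

lemma component_list_Cycle:
  assumes "Cycle l j \<in> cycle_components cs"
  shows "component_list cs P (Cycle l j) \<in> set cs" "length (component_list cs P (Cycle l j)) = l"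
proof -
  have "filter (\<lambda>c. length c = l) cs ! j \<in> set (filter (\<lambda>c. length c = l) cs)"
    using assms by (intro nth_mem) (simp add: cycle_components_def)
  then show "component_list cs P (Cycle l j) \<in> set cs" "length (component_list cs P (Cycle l j)) = l"
    by (auto simp: component_list_def)
qed

lemma distinct_component_list:
  assumes "distinct (concat cs @ P)" "k \<in> insert Path (cycle_components cs)"
  shows "distinct (component_list cs P k)"
proof (cases k)
  case (Cycle l j)
  then have "component_list cs P k \<in> set cs" using assms(2) component_list_Cycle(1) by auto
  then show ?thesis using assms(1) by (auto simp: distinct_concat_iff)
qed (use assms in \<open>auto simp: component_list_def\<close>)

lemma labels_mset:
  "(\<Sum>k\<in>insert Path (cycle_components cs). mset (component_list cs P k)) = mset (concat cs @ P)"
proof -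
  have "Path \<notin> cycle_components cs" by (auto simp: cycle_components_def)
  moreover have "(\<Sum>c\<leftarrow>cs. mset c) = mset (concat cs)" by (induction cs) auto
  moreover have "component_list cs P Path = P" by (simp add: component_list_def)
  ultimately show ?thesis
    using sum_components(1)[of cs] sum_components(2)[where cs = cs and g = mset and P = P] by (simp add: add.commute)
qed

lemma mset_image_nth: "mset xs = image_mset ((!) xs) (mset_set {..<length xs})"
  by (metis atLeast0LessThan map_nth mset_map mset_upt)

lemma assembly:
  fixes L0 L1 :: "nat multiset" and cs :: "int list list" and P :: "int list"
  assumes cs: "mset (map length cs) = L0 + L1 + replicate_mset a 2" and pos: "\<forall>c\<in>set cs. length c \<ge> 2"
    and P: "length P = Suc m" and V: "mset (concat cs @ P) = mset_set {0..int \<epsilon>}"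
  defines "G \<equiv> cycles_path_graph L0 L1 a m"
  shows "labeling (component_label cs P) G" "verts (map_mgraph (component_label cs P) G) = {0..int \<epsilon>}"
    "differences (map_mgraph (component_label cs P) G) = plus_minus (path_diffs P + cycles_diffs cs)"
    "path_differences m (component_label cs P) = plus_minus (path_diffs P)"
proof -
  let ?f = "component_label cs P"
  let ?I = "insert Path (cycle_components cs)"
  have I: "components (L0 + L1 + replicate_mset a 2) = ?I"
    unfolding components_def cycle_components_def cs[symmetric] count_length_filter ..
  have fin: "finite (cycle_components cs)" by (rule sum_components)
  have dist: "distinct (concat cs @ P)"
    using V by (metis distinct_count_atmost_1 finite_atLeastAtMost_int count_mset_set(1,3) set_mset_mset finite_set_mset_mset_set)
  have verts: "verts (component_graph m k) = {..<length (component_list cs P k)}" if "k \<in> ?I" for k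
  proof (cases k)
    case Path
    then show ?thesis using P by (simp add: path_graph_def component_list_def lessThan_Suc_atMost)
  next
    case (Cycle l j)
    then have "length (component_list cs P k) = l" using that component_list_Cycle(2) by auto
    then show ?thesis using Cycle by (simp add: cycle_graph_def)
  qed
  have vG: "verts G = (SIGMA k:?I. {..<length (component_list cs P k)})"
    unfolding G_def cycles_path_graph_def I disjoint_union_def using verts
    by (auto simp: map_mgraph_def)
  have fV: "finite (verts G)" unfolding vG using fin by auto
  have "image_mset ?f (mset_set (verts G)) = (\<Sum>k\<in>?I. mset (component_list cs P k))"
  proof -
    have "mset_set (SIGMA k:J. {..<length (component_list cs P k)}) =
        (\<Sum>k\<in>J. image_mset (Pair k) (mset_set {..<length (component_list cs P k)}))" if "finite J" for J
      using that
    proof (induction J rule: finite_induct)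
      case (insert k J)
      have "(SIGMA k:insert k J. {..<length (component_list cs P k)}) =
          Pair k ` {..<length (component_list cs P k)} \<union> (SIGMA k:J. {..<length (component_list cs P k)})" by auto
      moreover have "image_mset (Pair k) (mset_set {..<length (component_list cs P k)}) =
          mset_set (Pair k ` {..<length (component_list cs P k)})"
        by (rule image_mset_mset_set) (auto simp: inj_on_def)
      ultimately show ?case using insert
        by (subst (1) \<open>(SIGMA k:insert k J. _ k) = _\<close>) (subst mset_set_Union, auto)
    qed simp
    from this[of ?I] have "image_mset ?f (mset_set (verts G)) =
        image_mset ?f (\<Sum>k\<in>?I. image_mset (Pair k) (mset_set {..<length (component_list cs P k)}))"
      using fin vG by simp
    also have "\<dots> = (\<Sum>k\<in>?I. image_mset ?f (image_mset (Pair k) (mset_set {..<length (component_list cs P k)})))"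
      using fin by (intro image_mset_sum) simp
    also have "\<dots> = (\<Sum>k\<in>?I. mset (component_list cs P k))"
      by (intro sum.cong) (auto simp: mset_image_nth[of "component_list cs P k" for k] image_mset.compositionality comp_def component_label_nth)
    finally show ?thesis .
  qed
  then have im: "image_mset ?f (mset_set (verts G)) = mset_set {0..int \<epsilon>}"
    using labels_mset[of cs P] V by simp
  show vf: "verts (map_mgraph ?f G) = {0..int \<epsilon>}"
  proof -
    have "set_mset (image_mset ?f (mset_set (verts G))) = {0..int \<epsilon>}" unfolding im by simp
    then show ?thesis using fV by (simp add: map_mgraph_def)
  qed
  \<comment> \<open>Injectivity follows by counting: the image is
    \<open>{0..int \<epsilon>}\<close>, and there are as many vertices as elements of it.\<close>
  show "labeling ?f G"
  proof -
    have "card (verts G) = card {0..int \<epsilon>}"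
      using arg_cong[OF im, of size] by simp
    then show ?thesis
      using vf fV unfolding labeling_def by (auto simp: map_mgraph_def intro: eq_card_imp_inj_on)
  qed
  have pe: "edge_diffs (image_mset (image ?f) (edges (map_mgraph (Pair Path) (path_graph m)))) = plus_minus (path_diffs P)"
    using path_edge_diffs[of P m] P dist
    by (simp add: map_mgraph_def path_graph_def image_mset.compositionality comp_def)
  then show "path_differences m ?f = plus_minus (path_diffs P)"
    by (simp add: path_differences_def differences_edge_diffs path_part_def) (simp add: map_mgraph_def)
  have ce: "edge_diffs (image_mset (image ?f) (edges (map_mgraph (Pair k) (component_graph m k)))) =
      plus_minus (cycle_diffs (component_list cs P k))" if k: "k \<in> cycle_components cs" for k
  proof -
    obtain l j where lj: "k = Cycle l j" using k by (auto simp: cycle_components_def)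
    then have l: "length (component_list cs P k) = l" "l \<ge> 2"
      using k pos component_list_Cycle[of l j cs P] by auto
    have d: "distinct (component_list cs P k)" by (rule distinct_component_list[OF dist]) (use k in auto)
    show ?thesis
      using cycle_edge_diffs[OF d l] lj
      by (simp add: map_mgraph_def cycle_graph_def image_mset.compositionality comp_def component_label_nth del: component_label.simps)
  qed
  have "differences (map_mgraph ?f G) =
      edge_diffs (\<Sum>k\<in>?I. image_mset (image ?f) (edges (map_mgraph (Pair k) (component_graph m k))))"
    unfolding differences_edge_diffs G_def cycles_path_graph_def I disjoint_union_def
    using fin by (simp add: map_mgraph_def image_mset_sum)
  also have "\<dots> = plus_minus (path_diffs P) + (\<Sum>k\<in>cycle_components cs. plus_minus (cycle_diffs (component_list cs P k)))"
  proof -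
    have "Path \<notin> cycle_components cs" by (auto simp: cycle_components_def)
    then show ?thesis using fin pe ce by (simp add: edge_diffs_sum)
  qed
  also have "\<dots> = plus_minus (path_diffs P + cycles_diffs cs)"
    using sum_components(2)[where g = "\<lambda>c. plus_minus (cycle_diffs c)" and cs = cs and P = P]
    by (simp add: plus_minus_add cycles_diffs_def plus_minus_sum_list)
  finally show "differences (map_mgraph ?f G) = plus_minus (path_diffs P + cycles_diffs cs)" .
qed

lemma cycles_diffs_shift: "cycles_diffs (map (map (\<lambda>z. z - c)) cs) = cycles_diffs cs"
proof -
  have "cycle_diffs (map (\<lambda>z. z - c) xs) = cycle_diffs xs" for xs
    by (cases "xs = []") (simp_all add: cycle_diffs_def path_diffs_map last_map hd_map)
  then show ?thesis by (simp add: cycles_diffs_def comp_def)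
qed

theorem theorem5p9:
  fixes L0 L1 :: "nat multiset" and a \<epsilon> :: nat
  assumes "\<And>l. l \<in># L0 \<Longrightarrow> l mod 2 = 0 \<and> l > 2"
    and "\<And>l. l \<in># L1 \<Longrightarrow> l mod 2 = 1 \<and> l > 2"
    and "a \<in> {0, 1}"
    and "\<epsilon> \<ge> 6 * eps0 L0 + 7 * eps1 L1 a + 9"
  shows "\<exists>f. graceful_labeling L0 L1 a (\<epsilon> - sum_mset (L0 + L1) - 2 * a) f \<and>
           mset_set {int (4 * eps0 L0 + 5 * eps1 L1 a + 7)..int \<epsilon>}
             \<subseteq># path_differences (\<epsilon> - sum_mset (L0 + L1) - 2 * a) f"
proof -
  obtain x s e cs P where st: "end_labeling (a = 1) x s (int \<epsilon>) e cs P"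
    and cs: "mset (map length cs) = L0 + L1 + replicate_mset a 2"
    and sub: "mset_set {int (4 * eps0 L0 + 5 * eps1 L1 a + 7)..int \<epsilon>} \<subseteq># path_diffs P"
    using end_labeling_exists[OF assms] by blast
  \<comment> \<open>The constructed interval may lie anywhere and run in either direction;
    subtracting its least element moves it to \<open>{0..int \<epsilon>}\<close>.\<close>
  define A where "A = min x (x + s * int \<epsilon>)"
  define m where "m = \<epsilon> - sum_mset (L0 + L1) - 2 * a"
  let ?cs = "map (map (\<lambda>z. z - A)) cs" and ?P = "map (\<lambda>z. z - A) P"
  have "\<bar>s\<bar> = 1" and Pne: "P \<noteq> []" and D: "path_diffs P + cycles_diffs cs = diffs_upto (a = 1) (int \<epsilon>)"
    and iv: "mset P + mset (concat cs) = interval x s (int \<epsilon>)"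
    using st by (simp_all add: end_labeling_def)
  then have "interval x s (int \<epsilon>) = mset_set {A..A + int \<epsilon>}"
    unfolding interval_def A_def by (cases rule: unit_cases) (simp_all add: min_def max_def)
  then have V: "mset (concat cs @ P) = mset_set {A..A + int \<epsilon>}"
    using iv by (simp add: add.commute)
  have "mset (concat ?cs @ ?P) = image_mset (\<lambda>z. z - A) (mset (concat cs @ P))"
    by (simp add: map_concat flip: mset_map)
  also have "\<dots> = mset_set {0..int \<epsilon>}"
    unfolding V by (subst image_mset_mset_set) (auto simp: inj_on_def)
  finally have V': "mset (concat ?cs @ ?P) = mset_set {0..int \<epsilon>}" .
  have cs': "mset (map length ?cs) = L0 + L1 + replicate_mset a 2"
    using cs by (simp add: comp_def)
  have pos: "\<forall>c\<in>set ?cs. length c \<ge> 2"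
  proof
    fix c assume "c \<in> set ?cs"
    then have "length c \<in># L0 + L1 + replicate_mset a 2"
      unfolding cs'[symmetric] by auto
    then show "length c \<ge> 2" using assms(1,2)[of "length c"] by (auto split: if_splits)
  qed
  have "length (concat cs) = sum_mset (mset (map length cs))"
    by (simp only: length_concat sum_mset_sum_list)
  then have "length (concat cs) = sum_mset (L0 + L1) + 2 * a"
    unfolding cs by simp
  moreover have "length (concat cs) + length P = Suc \<epsilon>"
    using arg_cong[OF V, of size] by simp
  \<comment> \<open>As the path has at least one vertex, the subtractions defining \<open>m\<close>
    are not truncated.\<close>
  moreover have "length P \<ge> 1" using Pne by (cases P) auto
  ultimately have len: "length ?P = Suc m" "sum_mset (L0 + L1) + 2 * a + m = \<epsilon>"
    by (simp_all add: m_def)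
  have pdP: "path_diffs ?P = path_diffs P" by (rule path_diffs_map) simp
  note as = assembly[OF cs' pos len(1) V']
  have "a = 0 \<and> plus_minus (path_diffs P + cycles_diffs cs) = plus_minus (mset_set {1..int \<epsilon>}) \<or>
      a = 1 \<and> plus_minus (path_diffs P + cycles_diffs cs) = plus_minus {#1, 3, 3#} + plus_minus (mset_set {4..int \<epsilon>})"
    using assms(3) unfolding D diffs_upto_def plus_minus_add[symmetric] by (cases "a = 1") simp_all
  then have "graceful_labeling L0 L1 a m (component_label ?cs ?P)"
    unfolding graceful_labeling_def Let_def size_edges_cycles_path_graph len(2) as(3) pdP cycles_diffs_shift
    using as(1,2) by blast
  moreover have "mset_set {int (4 * eps0 L0 + 5 * eps1 L1 a + 7)..int \<epsilon>} \<subseteq># path_differences m (component_label ?cs ?P)"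
    unfolding as(4) pdP plus_minus_def by (rule subset_mset.order_trans[OF sub]) simp
  ultimately show ?thesis unfolding m_def by blast
qed

end
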